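(* Let $N=1$ and consider the generalized Korteweg-de Vries equations $\partial_t u+\partial_x(\partial_x^2u+2u^q)=0$, $q\in\{2,3,4,\dots\}$. Consider quasimonochromatic breathers of these equations (as defined in the context) whose profile $F$ is real analytic in a neighborhood of $0$, with $F(0)=0$. Then the function $$B(t,x)=-2\,\partial_x\arctan\left(\sqrt3\,\frac{\sin(2\alpha x-64\alpha^3t+x_1)}{\cosh(2\sqrt3\,\alpha x+x_2)}\right),\qquad \alpha>0,\ x_1,x_2\in\mathbb R,$$ which solves the equation with $q=3$, is, up to the scaling and shift symmetries of the equation, the unique nonzero solution of this form. That is: for $q\neq3$ there is no nonzero quasimonochromatic breather with $F$ real analytic near $0$; for $q=3$, $B$ is (up to shifts) such a breather, and every nonzero quasimonochromatic breather with $F$ real analytic near $0$ coincides with $B$ up to the scaling and shift symmetries.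
   Context: A function $u:\mathbb R\times\mathbb R\to\mathbb R$ is a quasimonochromatic breather of $\partial_tu+\partial_x(\partial_x^2u+2u^q)=0$ if it is a smooth solution of this equation of the form $$u(t,x)=\partial_x\big(F(p(x)\sin(2\alpha(x+mt)))\big),\qquad (t,x)\in\mathbb R\times\mathbb R,$$ where $m\in\mathbb R$, $\alpha>0$, and $F\in C^\infty(\mathbb R)$, $p\in C^2(\mathbb R)$ are nontrivial functions such that $F(0)=0$ and $p(x),p'(x),p''(x)\to0$ as $|x|\to\infty$. The scaling and shift symmetries (for $q=3$) are $u(t,x)\mapsto \lambda u(\lambda^3(t+t_0),\lambda(x+x_0))$ with $\lambda>0$, $t_0,x_0\in\mathbb R$. The numbers $x_1,x_2$ in $B$ are free real shifts. *)

theory Defs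
  imports "HOL-Analysis.Analysis"
begin

definition C_k :: "nat \<Rightarrow> (real \<Rightarrow> real) \<Rightarrow> bool" where
  "C_k k f \<longleftrightarrow>
     (\<forall>j<k. \<forall>x. (deriv ^^ j) f differentiable (at x)) \<and> continuous_on UNIV ((deriv ^^ k) f)"

definition smooth :: "(real \<Rightarrow> real) \<Rightarrow> bool" where
  "smooth f \<longleftrightarrow> (\<forall>k. C_k k f)"

text \<open>Joint \<open>C\<^sup>k\<close> regularity on the plane: all mixed partial derivatives up to order \<open>k\<close>
  exist and are jointly continuous.  The witnesses \<open>ut\<close>, \<open>ux\<close> are the two partial derivatives.\<close>

primrec C_k_plane :: "nat \<Rightarrow> (real \<Rightarrow> real \<Rightarrow> real) \<Rightarrow> bool" where
  "C_k_plane 0 u \<longleftrightarrow> continuous_on UNIV (\<lambda>(t, x). u t x)"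
| "C_k_plane (Suc k) u \<longleftrightarrow>
     (\<exists>ut ux. (\<forall>t x. ((\<lambda>s. u s x) has_real_derivative ut t x) (at t)) \<and>
              (\<forall>t x. ((\<lambda>y. u t y) has_real_derivative ux t x) (at x)) \<and>
              C_k_plane k ut \<and> C_k_plane k ux)"

definition smooth_plane :: "(real \<Rightarrow> real \<Rightarrow> real) \<Rightarrow> bool" where
  "smooth_plane u \<longleftrightarrow> (\<forall>k. C_k_plane k u)"

definition real_analytic_on :: "(real \<Rightarrow> real) \<Rightarrow> real set \<Rightarrow> bool" where
  "real_analytic_on f S \<longleftrightarrow> (\<forall>x\<in>S. \<exists>G. (\<lambda>h. f (x + h)) has_fps_expansion G)"

text \<open>Functions of \<open>(t, x)\<close> are curried, with the time variable first.\<close>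

definition gKdV_smooth_solution :: "nat \<Rightarrow> (real \<Rightarrow> real \<Rightarrow> real) \<Rightarrow> bool" where
  "gKdV_smooth_solution q u \<longleftrightarrow>
     smooth_plane u \<and>
     (\<forall>t x. deriv (\<lambda>s. u s x) t + deriv (\<lambda>y. (deriv ^^ 2) (u t) y + 2 * u t y ^ q) x = 0)"

definition quasimonochromatic_breather_with ::
  "nat \<Rightarrow> real \<Rightarrow> real \<Rightarrow> (real \<Rightarrow> real) \<Rightarrow> (real \<Rightarrow> real) \<Rightarrow> (real \<Rightarrow> real \<Rightarrow> real) \<Rightarrow> bool"
where
  "quasimonochromatic_breather_with q m \<alpha> F p u \<longleftrightarrow>
     gKdV_smooth_solution q u \<and>
     (\<forall>t x. u t x = deriv (\<lambda>y. F (p y * sin (2 * \<alpha> * (y + m * t)))) x) \<and>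
     \<alpha> > 0 \<and>
     smooth F \<and> F \<noteq> (\<lambda>_. 0) \<and> F 0 = 0 \<and>
     C_k 2 p \<and> p \<noteq> (\<lambda>_. 0) \<and>
     (p \<longlongrightarrow> 0) at_infinity \<and>
     (deriv p \<longlongrightarrow> 0) at_infinity \<and>
     ((deriv ^^ 2) p \<longlongrightarrow> 0) at_infinity"

definition quasimonochromatic_breather_analytic_profile ::
  "nat \<Rightarrow> (real \<Rightarrow> real \<Rightarrow> real) \<Rightarrow> bool"
where
  "quasimonochromatic_breather_analytic_profile q u \<longleftrightarrow>
     (\<exists>m \<alpha> F p. quasimonochromatic_breather_with q m \<alpha> F p u \<and>
        (\<exists>U. open U \<and> 0 \<in> U \<and> real_analytic_on F U))"

definition B :: "real \<Rightarrow> real \<Rightarrow> real \<Rightarrow> real \<Rightarrow> real \<Rightarrow> real" where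
  "B \<alpha> x1 x2 t x =
     - 2 * deriv (\<lambda>y. arctan (sqrt 3 *
       (sin (2 * \<alpha> * y - 64 * \<alpha> ^ 3 * t + x1) / cosh (2 * sqrt 3 * \<alpha> * y + x2)))) x"

end

theory Submission
  imports Defs
begin

text \<open>Write \<open>a = 2\<alpha>\<close> and \<open>u = \<partial>\<^sub>x v\<close> with \<open>v = F(y)\<close>, \<open>y = p(x) sin \<phi>\<close>, \<open>\<phi> = a (x + m t)\<close>.  Integrating the equation
once in \<open>x\<close> gives \<open>v\<^sub>t + u\<^sub>x\<^sub>x + 2 u\<^sup>q = c(t)\<close>, and the decay of the envelope \<open>p\<close> forces \<open>c = 0\<close>
(\<open>integrated_equation\<close>).  If \<open>m = 0\<close>, then \<open>u\<close> is a stationary solution of a conservative oscillator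
that decays at infinity, so \<open>u = 0\<close> (\<open>stationary_trivial\<close>).

If \<open>m \<noteq> 0\<close>, the position \<open>x\<close> and the phase \<open>\<phi>\<close> are independent variables: at one fixed \<open>x\<close> the
integrated equation holds for every \<open>\<phi>\<close> (\<open>residual_zero\<close>).  At a peak of the envelope it is an
ordinary differential equation for \<open>F'\<close>, so \<open>F'\<close> and \<open>F''\<close> cannot both vanish at \<open>0\<close> unless \<open>u = 0\<close>
(\<open>profile_nondegenerate\<close>); this also provides the derivative \<open>p'''\<close> wherever \<open>p \<noteq> 0\<close>
(\<open>p2_has_derivative\<close>).  At the nodes \<open>\<phi> = 0\<close> and \<open>\<phi> = \<pi>\<close>, where \<open>y = 0\<close>, the equation and its
\<open>\<phi>\<close>-derivative split into relations between \<open>p\<close>, \<open>p'\<close>, \<open>p''\<close>, \<open>p'''\<close> and the Taylor coefficients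
of \<open>F\<close> at \<open>0\<close>.  For even \<open>q\<close> these are contradictory (\<open>odd_power\<close>).  For odd \<open>q\<close> they give
\<open>F''(0) = 0\<close>, a second-order equation for \<open>p\<close> and a third-order equation for \<open>p\<close>; comparing the
latter with the derivative of the former leaves a polynomial in \<open>p\<close> that vanishes for infinitely
many values of \<open>p\<close>.  Its coefficients are zero only if \<open>q = 3\<close>, \<open>m = - 8 a\<^sup>2\<close> and
\<open>F'''(0) = - F'(0)\<^sup>3 / 2\<close> (\<open>power_is_3\<close>).

For \<open>q = 3\<close> the second-order equation has a conserved energy, which vanishes by decay, and
\<open>1 / p\<close> then solves the linear equation \<open>h'' = 3 a\<^sup>2 h\<close>; so \<open>p\<close> is a multiple of a translated hyperbolic
secant (\<open>envelope_sech\<close>).  The part of the equation that is odd under \<open>\<phi> \<mapsto> \<pi> - \<phi>\<close> is, for a fixed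
value of \<open>y\<close>, affine in \<open>p(x)\<^sup>2\<close>; as \<open>p(x)\<^sup>2\<close> takes more than one value, both coefficients vanish.
Eliminating \<open>F'''\<close> between them leaves a linear first-order equation for \<open>F'\<close>, whose solution is
the derivative of \<open>2 arctan (F'(0) y / 2)\<close> (\<open>profile_slope\<close>).  The frequency \<open>\<alpha>\<close>, the phase and
the position of the centre are absorbed by scaling and translations.

Conversely \<open>B\<close> has this form, and the identities \<open>p'\<^sup>2 = 3 a\<^sup>2 p\<^sup>2 - a\<^sup>2 p\<^sup>4 / 4\<close> and
\<open>F'' = - 2 y F' / (4 + y\<^sup>2)\<close> make the integrated equation an algebraic identity
(\<open>residual_zero_arctan_sech\<close>).\<close>

section \<open>Differential inequalities and limits\<close>

text \<open>Both \<open>N e\<^sup>-\<^sup>K\<^sup>x\<close> to the right of \<open>z\<close> and \<open>N e\<^sup>K\<^sup>x\<close> to the left of \<open>z\<close> move monotonically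
down, away from the value \<open>0\<close> at \<open>z\<close>, and they are nonnegative.\<close>

lemma gronwall_zero:
  fixes N N' :: "real \<Rightarrow> real"
  assumes deriv: "\<And>x. x \<in> {l..r} \<Longrightarrow> (N has_real_derivative N' x) (at x)"
    and bound: "\<And>x. x \<in> {l..r} \<Longrightarrow> \<bar>N' x\<bar> \<le> K * N x"
    and nonneg: "\<And>x. x \<in> {l..r} \<Longrightarrow> N x \<ge> 0"
    and z: "z \<in> {l..r}" "N z = 0" and x: "x \<in> {l..r}"
  shows "N x = 0"
proof (cases "z \<le> x")
  case True
  have "N x * exp (- K * x) \<le> N z * exp (- K * z)"
  proof (rule DERIV_nonpos_imp_nonincreasing[OF True])
    fix w assume w: "z \<le> w" "w \<le> x"
    hence wi: "w \<in> {l..r}" using z x by auto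
    have "((\<lambda>x. N x * exp (- K * x)) has_real_derivative (N' w - K * N w) * exp (- K * w)) (at w)"
      using deriv[OF wi] by (auto intro!: derivative_eq_intros simp: algebra_simps)
    moreover have "(N' w - K * N w) * exp (- K * w) \<le> 0"
      using bound[OF wi] by (intro mult_nonpos_nonneg) auto
    ultimately show "\<exists>y. ((\<lambda>x. N x * exp (- K * x)) has_real_derivative y) (at w) \<and> y \<le> 0"
      by blast
  qed
  thus ?thesis using nonneg[OF x] z(2) by (simp add: mult_le_0_iff)
next
  case False
  hence le: "x \<le> z" by simp
  have "N x * exp (K * x) \<le> N z * exp (K * z)"
  proof (rule DERIV_nonneg_imp_nondecreasing[OF le])
    fix w assume w: "x \<le> w" "w \<le> z"
    hence wi: "w \<in> {l..r}" using z x by auto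
    have "((\<lambda>x. N x * exp (K * x)) has_real_derivative (N' w + K * N w) * exp (K * w)) (at w)"
      using deriv[OF wi] by (auto intro!: derivative_eq_intros simp: algebra_simps)
    moreover have "(N' w + K * N w) * exp (K * w) \<ge> 0"
      using bound[OF wi] by (intro mult_nonneg_nonneg) auto
    ultimately show "\<exists>y. ((\<lambda>x. N x * exp (K * x)) has_real_derivative y) (at w) \<and> y \<ge> 0"
      by blast
  qed
  thus ?thesis using nonneg[OF x] z(2) by (simp add: mult_le_0_iff)
qed

text \<open>The Gronwall bound applies to \<open>g\<^sup>2 + h\<^sup>2\<close>, with a constant obtained from bounds of the continuous
coefficients on the compact interval.  This form covers \<open>g'' + b g' + c g = 0\<close> and also nonlinear
equations in which the nonlinearity has been put into a coefficient of \<open>g\<close>.\<close>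

lemma linear_system_unique_zero:
  fixes g h A C D :: "real \<Rightarrow> real"
  assumes g: "\<And>x. x \<in> {l..r} \<Longrightarrow> (g has_real_derivative A x * h x) (at x)"
    and h: "\<And>x. x \<in> {l..r} \<Longrightarrow> (h has_real_derivative C x * g x + D x * h x) (at x)"
    and cont: "continuous_on {l..r} A" "continuous_on {l..r} C" "continuous_on {l..r} D"
    and z: "z \<in> {l..r}" "g z = 0" "h z = 0" and x: "x \<in> {l..r}"
  shows "g x = 0"
proof -
  have bdd: "\<exists>K. \<forall>x\<in>{l..r}. \<bar>f x\<bar> \<le> K" if "continuous_on {l..r} f" for f :: "real \<Rightarrow> real"
    using compact_imp_bounded[OF compact_continuous_image[OF that compact_Icc]]
    unfolding bounded_iff by auto
  obtain KA KC KD where K: "\<And>x. x \<in> {l..r} \<Longrightarrow> \<bar>A x\<bar> \<le> KA"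
      "\<And>x. x \<in> {l..r} \<Longrightarrow> \<bar>C x\<bar> \<le> KC" "\<And>x. x \<in> {l..r} \<Longrightarrow> \<bar>D x\<bar> \<le> KD"
    using bdd[OF cont(1)] bdd[OF cont(2)] bdd[OF cont(3)] by blast
  define N where "N = (\<lambda>x. (g x)\<^sup>2 + (h x)\<^sup>2)"
  have "N x = 0"
  proof (rule gronwall_zero[where N = N and N' = "\<lambda>x. 2 * ((A x + C x) * (g x * h x) + D x * (h x)\<^sup>2)"
        and K = "KA + KC + 2 * KD"])
    fix w assume w: "w \<in> {l..r}"
    show "(N has_real_derivative 2 * ((A w + C w) * (g w * h w) + D w * (h w)\<^sup>2)) (at w)"
      unfolding N_def using g[OF w] h[OF w]
      by (auto intro!: derivative_eq_intros simp: algebra_simps power2_eq_square)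
    have gh: "2 * \<bar>g w * h w\<bar> \<le> N w"
      using sum_squares_bound[of "\<bar>g w\<bar>" "\<bar>h w\<bar>"] unfolding N_def by (simp add: abs_mult)
    have Np: "0 \<le> N w" "(h w)\<^sup>2 \<le> N w" unfolding N_def by auto
    have "\<bar>A w + C w\<bar> \<le> KA + KC" using K(1,2)[OF w] by linarith
    hence "\<bar>A w + C w\<bar> * (2 * \<bar>g w * h w\<bar>) \<le> (KA + KC) * N w" using gh by (intro mult_mono) auto
    moreover have "\<bar>D w\<bar> * (h w)\<^sup>2 \<le> KD * N w" using K(3)[OF w] Np by (intro mult_mono) auto
    moreover have "\<bar>2 * ((A w + C w) * (g w * h w) + D w * (h w)\<^sup>2)\<bar>
        \<le> \<bar>A w + C w\<bar> * (2 * \<bar>g w * h w\<bar>) + 2 * (\<bar>D w\<bar> * (h w)\<^sup>2)"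
      using abs_triangle_ineq[of "(A w + C w) * (g w * h w)" "D w * (h w)\<^sup>2"]
        abs_mult[of "A w + C w" "g w * h w"] abs_mult[of "D w" "(h w)\<^sup>2"]
        abs_mult[of 2 "(A w + C w) * (g w * h w) + D w * (h w)\<^sup>2"] by simp
    ultimately show "\<bar>2 * ((A w + C w) * (g w * h w) + D w * (h w)\<^sup>2)\<bar> \<le> (KA + KC + 2 * KD) * N w"
      by (simp add: algebra_simps)
    show "0 \<le> N w" by (rule Np)
  qed (use z x in \<open>auto simp: N_def\<close>)
  thus ?thesis by (simp add: N_def sum_power2_eq_zero_iff)
qed

text \<open>Used for the envelope and for stationary solutions: at such a point all terms containing the first
derivative drop out, while the function itself is nonzero.\<close>

lemma vanishing_at_infinity_attains_max_abs:
  fixes f f' :: "real \<Rightarrow> real"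
  assumes deriv: "\<And>x. (f has_real_derivative f' x) (at x)"
    and lim: "(f \<longlongrightarrow> 0) at_infinity" and nz: "f z \<noteq> 0"
  obtains x where "f x \<noteq> 0" "f' x = 0" "\<And>y. \<bar>f y\<bar> \<le> \<bar>f x\<bar>"
proof -
  have "\<forall>\<^sub>F x in at_infinity. \<bar>f x\<bar> < \<bar>f z\<bar>"
    using order_tendstoD(2)[OF tendsto_rabs[OF lim], of "\<bar>f z\<bar>"] nz by simp
  then obtain R where R: "\<And>x. R \<le> \<bar>x\<bar> \<Longrightarrow> \<bar>f x\<bar> < \<bar>f z\<bar>"
    unfolding eventually_at_infinity by auto
  have zR: "\<bar>z\<bar> < R" using R[of z] by force
  have cont: "continuous_on {-R..R} (\<lambda>x. \<bar>f x\<bar>)"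
    by (intro continuous_on_rabs continuous_at_imp_continuous_on ballI DERIV_isCont[OF deriv])
  obtain x where x: "x \<in> {-R..R}" "\<And>y. y \<in> {-R..R} \<Longrightarrow> \<bar>f y\<bar> \<le> \<bar>f x\<bar>"
    using continuous_attains_sup[OF compact_Icc _ cont] zR by (metis abs_le_iff atLeastAtMost_iff empty_iff less_imp_le minus_le_iff)
  have fz: "\<bar>f z\<bar> \<le> \<bar>f x\<bar>" using zR by (intro x) auto
  have mx: "\<bar>f y\<bar> \<le> \<bar>f x\<bar>" for y
    using x(2)[of y] R[of y] fz by (smt (verit) atLeastAtMost_iff)
  have fx: "f x \<noteq> 0" using fz nz by auto
  have sq: "((\<lambda>x. (f x)\<^sup>2) has_real_derivative 2 * f x * f' x) (at x)"
    using deriv[of x] by (auto intro!: derivative_eq_intros)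
  have "2 * f x * f' x = 0"
    by (rule DERIV_local_max[OF sq zero_less_one]) (use mx in \<open>auto simp: abs_le_square_iff\<close>)
  with that fx mx show ?thesis by auto
qed

text \<open>By the mean value theorem \<open>g'\<close> takes the value \<open>g (1 + x) - g x\<close> between \<open>x\<close> and \<open>1 + x\<close>, and
this difference tends to \<open>0\<close>.\<close>

lemma limit_of_derivative_zero:
  fixes g g' :: "real \<Rightarrow> real"
  assumes deriv: "\<And>x. (g has_real_derivative g' x) (at x)"
    and g: "(g \<longlongrightarrow> l) at_top" and g': "(g' \<longlongrightarrow> c) at_top"
  shows "c = 0"
proof -
  have "\<exists>z. x < z \<and> z < 1 + x \<and> g (1 + x) - g x = g' z" for x
    using MVT2[of x "1 + x" g g'] deriv by auto
  then obtain \<xi> where \<xi>: "\<And>x. x < \<xi> x" "\<And>x. g (1 + x) - g x = g' (\<xi> x)" by metis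
  have "filterlim \<xi> at_top at_top"
    by (rule filterlim_at_top_mono[OF filterlim_ident]) (simp add: \<xi>(1) less_imp_le)
  hence "((\<lambda>x. g' (\<xi> x)) \<longlongrightarrow> c) at_top" by (rule filterlim_compose[OF g'])
  moreover have "((\<lambda>x. g (1 + x) - g x) \<longlongrightarrow> l - l) at_top"
    by (intro tendsto_diff g filterlim_compose[OF g]
        filterlim_tendsto_add_at_top[OF tendsto_const] filterlim_ident)
  ultimately show ?thesis using tendsto_unique[OF trivial_limit_at_top_linorder] by (simp add: \<xi>(2))
qed

lemma smooth_has_derivative:
  assumes "smooth f"
  shows "((deriv ^^ k) f has_real_derivative (deriv ^^ Suc k) f x) (at x)"
proof -
  have "(deriv ^^ k) f differentiable (at x)"
    using assms unfolding smooth_def C_k_def by (metis lessI)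
  thus ?thesis by (simp add: DERIV_deriv_iff_real_differentiable)
qed

lemma C_2_has_derivatives:
  assumes "C_k 2 f"
  shows "(f has_real_derivative deriv f x) (at x)"
    and "(deriv f has_real_derivative (deriv ^^ 2) f x) (at x)"
    and "continuous_on UNIV ((deriv ^^ 2) f)"
proof -
  have *: "\<forall>j<2. \<forall>x. (deriv ^^ j) f differentiable (at x)" and "continuous_on UNIV ((deriv ^^ 2) f)"
    using assms unfolding C_k_def by auto
  thus "continuous_on UNIV ((deriv ^^ 2) f)" by simp
  from *[rule_format, of 0 x] show "(f has_real_derivative deriv f x) (at x)"
    by (simp add: DERIV_deriv_iff_real_differentiable)
  from *[rule_format, of 1 x] show "(deriv f has_real_derivative (deriv ^^ 2) f x) (at x)"
    by (simp add: DERIV_deriv_iff_real_differentiable numeral_2_eq_2)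
qed

section \<open>The chain rule for a modulated wave\<close>

text \<open>The profile and the envelope with names for their derivatives.  Three derivatives of the envelope
enter the equation, but only two are available; where a third one exists is decided later, so its
value is a separate argument \<open>d\<close> below.\<close>

locale ansatz =
  fixes m a :: real and F F1 F2 F3 F4 p p1 p2 :: "real \<Rightarrow> real"
  assumes F: "\<And>x. (F has_real_derivative F1 x) (at x)"
    and F1: "\<And>x. (F1 has_real_derivative F2 x) (at x)"
    and F2: "\<And>x. (F2 has_real_derivative F3 x) (at x)"
    and F3: "\<And>x. (F3 has_real_derivative F4 x) (at x)"
    and p: "\<And>x. (p has_real_derivative p1 x) (at x)"
    and p1: "\<And>x. (p1 has_real_derivative p2 x) (at x)"
    and p2: "\<And>x. isCont p2 x"
begin

abbreviation \<theta> :: "real \<Rightarrow> real \<Rightarrow> real" where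
  "\<theta> t x \<equiv> a * (x + m * t)"

text \<open>The functions \<open>y1\<close>, \<open>y2\<close>, \<open>y3\<close> are the derivatives of \<open>y\<close> in \<open>x\<close>, and \<open>yt\<close> the derivative in \<open>t\<close>,
along the travelling phase.  They are written as functions of the position and the phase,
because these two are treated as independent once \<open>m \<noteq> 0\<close>.\<close>

definition y :: "real \<Rightarrow> real \<Rightarrow> real" where
  "y x \<phi> = p x * sin \<phi>"
definition y1 :: "real \<Rightarrow> real \<Rightarrow> real" where
  "y1 x \<phi> = p1 x * sin \<phi> + a * p x * cos \<phi>"
definition y2 :: "real \<Rightarrow> real \<Rightarrow> real" where
  "y2 x \<phi> = p2 x * sin \<phi> + 2 * a * p1 x * cos \<phi> - a\<^sup>2 * p x * sin \<phi>"
definition y3 :: "real \<Rightarrow> real \<Rightarrow> real \<Rightarrow> real" where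
  "y3 d x \<phi> = d * sin \<phi> + 3 * a * p2 x * cos \<phi> - 3 * a\<^sup>2 * p1 x * sin \<phi> - a ^ 3 * p x * cos \<phi>"
definition yt :: "real \<Rightarrow> real \<Rightarrow> real" where
  "yt x \<phi> = a * m * p x * cos \<phi>"

lemma deriv_y: "((\<lambda>x. y x (\<theta> t x)) has_real_derivative y1 x (\<theta> t x)) (at x)"
  unfolding y_def y1_def using p[of x] by (auto intro!: derivative_eq_intros)

lemma deriv_y1: "((\<lambda>x. y1 x (\<theta> t x)) has_real_derivative y2 x (\<theta> t x)) (at x)"
  unfolding y1_def y2_def using p[of x] p1[of x]
  by (auto intro!: derivative_eq_intros simp: algebra_simps power2_eq_square)

lemma deriv_y2:
  assumes "(p2 has_real_derivative d) (at x)"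
  shows "((\<lambda>x. y2 x (\<theta> t x)) has_real_derivative y3 d x (\<theta> t x)) (at x)"
  unfolding y2_def y3_def using p[of x] p1[of x] assms
  by (auto intro!: derivative_eq_intros simp: algebra_simps power2_eq_square power3_eq_cube)

lemma deriv_y_time: "((\<lambda>t. y x (\<theta> t x)) has_real_derivative yt x (\<theta> t x)) (at t)"
  unfolding y_def yt_def by (auto intro!: derivative_eq_intros)

lemma deriv_yt: "((\<lambda>x. yt x (\<theta> t x)) has_real_derivative
    a * m * (p1 x * cos (\<theta> t x) - a * p x * sin (\<theta> t x))) (at x)"
  unfolding yt_def using p[of x] by (auto intro!: derivative_eq_intros simp: algebra_simps)

lemma deriv_y1_time: "((\<lambda>t. y1 x (\<theta> t x)) has_real_derivative
    a * m * (p1 x * cos (\<theta> t x) - a * p x * sin (\<theta> t x))) (at t)"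
  unfolding y1_def by (auto intro!: derivative_eq_intros simp: algebra_simps)

text \<open>The wave \<open>u = \<partial>\<^sub>x F(y)\<close> and its first two \<open>x\<close>-derivatives.\<close>

definition u0 :: "real \<Rightarrow> real \<Rightarrow> real" where
  "u0 x \<phi> = F1 (y x \<phi>) * y1 x \<phi>"
definition u1 :: "real \<Rightarrow> real \<Rightarrow> real" where
  "u1 x \<phi> = F2 (y x \<phi>) * (y1 x \<phi>)\<^sup>2 + F1 (y x \<phi>) * y2 x \<phi>"
definition u2 :: "real \<Rightarrow> real \<Rightarrow> real \<Rightarrow> real" where
  "u2 d x \<phi> = F3 (y x \<phi>) * (y1 x \<phi>) ^ 3 + 3 * F2 (y x \<phi>) * y1 x \<phi> * y2 x \<phi> + F1 (y x \<phi>) * y3 d x \<phi>"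

lemma deriv_v: "((\<lambda>x. F (y x (\<theta> t x))) has_real_derivative u0 x (\<theta> t x)) (at x)"
  unfolding u0_def by (rule DERIV_chain2[OF F deriv_y])

lemma deriv_F1: "((\<lambda>x. F1 (y x (\<theta> t x))) has_real_derivative F2 (y x (\<theta> t x)) * y1 x (\<theta> t x)) (at x)"
  by (rule DERIV_chain2[OF F1 deriv_y])

lemma deriv_F2: "((\<lambda>x. F2 (y x (\<theta> t x))) has_real_derivative F3 (y x (\<theta> t x)) * y1 x (\<theta> t x)) (at x)"
  by (rule DERIV_chain2[OF F2 deriv_y])

lemma deriv_u0: "((\<lambda>x. u0 x (\<theta> t x)) has_real_derivative u1 x (\<theta> t x)) (at x)"
  unfolding u0_def u1_def
  by (rule DERIV_cong[OF DERIV_mult[OF deriv_F1 deriv_y1]]) (simp add: algebra_simps power2_eq_square)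

lemma deriv_u1:
  assumes "(p2 has_real_derivative d) (at x)"
  shows "((\<lambda>x. u1 x (\<theta> t x)) has_real_derivative u2 d x (\<theta> t x)) (at x)"
  unfolding u1_def u2_def
  by (rule DERIV_cong[OF DERIV_add[OF DERIV_mult[OF deriv_F2 DERIV_power[OF deriv_y1]]
          DERIV_mult[OF deriv_F1 deriv_y2[OF assms]]]])
     (simp add: algebra_simps power2_eq_square power3_eq_cube)

text \<open>Equality of the mixed partial derivatives of \<open>v = F(y)\<close>.  It turns \<open>\<partial>\<^sub>t u\<close> into an \<open>x\<close>-derivative, so
that the whole equation can be integrated in \<open>x\<close>.\<close>

lemma deriv_v_time_deriv_space:
  "((\<lambda>t. u0 x (\<theta> t x)) has_real_derivative D) (at t) \<longleftrightarrow>
   ((\<lambda>x. F1 (y x (\<theta> t x)) * yt x (\<theta> t x)) has_real_derivative D) (at x)"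
proof -
  define E where "E = F2 (y x (\<theta> t x)) * y1 x (\<theta> t x) * yt x (\<theta> t x) +
    F1 (y x (\<theta> t x)) * (a * m * (p1 x * cos (\<theta> t x) - a * p x * sin (\<theta> t x)))"
  have "((\<lambda>t. u0 x (\<theta> t x)) has_real_derivative E) (at t)"
    unfolding u0_def E_def
    by (rule DERIV_cong[OF DERIV_mult[OF DERIV_chain2[OF F1 deriv_y_time] deriv_y1_time]])
       (simp add: algebra_simps)
  moreover have "((\<lambda>x. F1 (y x (\<theta> t x)) * yt x (\<theta> t x)) has_real_derivative E) (at x)"
    unfolding E_def
    by (rule DERIV_cong[OF DERIV_mult[OF deriv_F1 deriv_yt]]) (simp add: algebra_simps)
  ultimately show ?thesis using DERIV_unique by blast
qed

lemma isCont_F1: "isCont F1 x" and isCont_F2: "isCont F2 x"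
  and isCont_p: "isCont p x" and isCont_p1: "isCont p1 x"
  using F1 F2 p p1 DERIV_isCont by blast+

text \<open>The left-hand side of \<open>v\<^sub>t + u\<^sub>x\<^sub>x + 2 u\<^sup>q = 0\<close> as a function of position and phase.\<close>

definition residual :: "nat \<Rightarrow> real \<Rightarrow> real \<Rightarrow> real \<Rightarrow> real" where
  "residual q d x \<phi> = F1 (y x \<phi>) * (yt x \<phi> + y3 d x \<phi>) + 3 * F2 (y x \<phi>) * y1 x \<phi> * y2 x \<phi>
     + F3 (y x \<phi>) * (y1 x \<phi>) ^ 3 + 2 * (F1 (y x \<phi>) * y1 x \<phi>) ^ q"

end

section \<open>The integrated equation at independent position and phase\<close>

text \<open>The ansatz with the integrated equation and a moving phase.  The equation is stated as a
differentiability property of \<open>u1\<close>: it makes sense without a third derivative of the envelope, and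
\<open>p2_differentiable\<close> extracts one from it.\<close>

locale breather = ansatz +
  fixes q :: nat
  assumes a_pos: "a > 0" and m_nz: "m \<noteq> 0" and q_ge: "q \<ge> 2"
    and p_nz: "\<exists>x. p x \<noteq> 0"
    and p_lim: "(p \<longlongrightarrow> 0) at_infinity" and p1_lim: "(p1 \<longlongrightarrow> 0) at_infinity"
    and equation: "\<And>t x. ((\<lambda>x. u1 x (\<theta> t x)) has_real_derivative
         - F1 (y x (\<theta> t x)) * yt x (\<theta> t x) - 2 * u0 x (\<theta> t x) ^ q) (at x)"
    and nontrivial: "\<exists>x \<phi>. u0 x \<phi> \<noteq> 0"
begin

lemma obtain_time: obtains t where "\<theta> t x = \<phi>"
proof
  show "\<theta> ((\<phi> / a - x) / m) x = \<phi>" using a_pos m_nz by (simp add: field_simps)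
qed

lemma residual_zero:
  assumes "(p2 has_real_derivative d) (at x)"
  shows "residual q d x \<phi> = 0"
proof -
  obtain t where t: "\<theta> t x = \<phi>" using obtain_time by blast
  have "u2 d x (\<theta> t x) = - F1 (y x (\<theta> t x)) * yt x (\<theta> t x) - 2 * u0 x (\<theta> t x) ^ q"
    by (rule DERIV_unique[OF deriv_u1[OF assms] equation])
  thus ?thesis unfolding t residual_def u2_def u0_def by (simp add: algebra_simps)
qed

text \<open>If the phase is chosen so that \<open>y = w\<close> at \<open>x\<close>, the only term of \<open>u1\<close> not yet known to be
differentiable is \<open>F'(y) p'' sin \<phi>\<close>, and its factor in front of \<open>p''\<close> is nonzero near \<open>x\<close>.\<close>

lemma p2_differentiable:
  assumes w: "w \<noteq> 0" "\<bar>w\<bar> \<le> \<bar>p x\<bar>" "F1 w \<noteq> 0"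
  obtains d where "(p2 has_real_derivative d) (at x)"
proof -
  have px: "p x \<noteq> 0" using w by auto
  define \<phi> where "\<phi> = arcsin (w / p x)"
  have "\<bar>w / p x\<bar> \<le> 1" using w px by (simp add: divide_le_eq)
  hence sin: "sin \<phi> = w / p x" unfolding \<phi>_def by (intro sin_arcsin; linarith)
  obtain t where t: "\<theta> t x = \<phi>" using obtain_time by blast
  have s: "sin (\<theta> t x) \<noteq> 0" and yx: "y x (\<theta> t x) = w"
    unfolding t y_def sin using w(1) px by simp_all
  define G where "G = (\<lambda>z. F1 (y z (\<theta> t z)) * sin (\<theta> t z))"
  define H where "H = (\<lambda>z. u1 z (\<theta> t z) - F2 (y z (\<theta> t z)) * (y1 z (\<theta> t z))\<^sup>2
    - F1 (y z (\<theta> t z)) * (2 * a * p1 z * cos (\<theta> t z) - a\<^sup>2 * p z * sin (\<theta> t z)))"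
  have HG: "H z = G z * p2 z" for z
    unfolding H_def G_def u1_def y2_def by (simp add: algebra_simps)
  have dif: "(\<lambda>x. u1 x (\<theta> t x)) differentiable (at x)" "(\<lambda>x. F2 (y x (\<theta> t x))) differentiable (at x)"
     "(\<lambda>x. F1 (y x (\<theta> t x))) differentiable (at x)" "(\<lambda>x. y1 x (\<theta> t x)) differentiable (at x)"
     "p differentiable (at x)" "p1 differentiable (at x)"
     "(\<lambda>x. sin (\<theta> t x)) differentiable (at x)" "(\<lambda>x. cos (\<theta> t x)) differentiable (at x)"
    unfolding real_differentiable_def
    using equation[of t x] deriv_F2[of t x] deriv_F1[of t x] deriv_y1[of t x] p[of x] p1[of x]
    by (blast, blast, blast, blast, blast, blast) (auto intro!: exI derivative_eq_intros)
  have Gd: "G differentiable (at x)" unfolding G_def by (intro derivative_intros dif)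
  have Hd: "H differentiable (at x)" unfolding H_def by (intro derivative_intros dif)
  have G0: "G x \<noteq> 0" unfolding G_def yx using s w by simp
  have "(\<lambda>z. H z / G z) differentiable (at x)"
    by (intro differentiable_divide Hd Gd G0)
  then obtain d where d: "((\<lambda>z. H z / G z) has_real_derivative d) (at x)"
    unfolding real_differentiable_def by blast
  have "isCont G x" using Gd differentiable_imp_continuous_within by blast
  hence "(G \<longlongrightarrow> G x) (nhds x)" by (simp add: isCont_def tendsto_at_iff_tendsto_nhds)
  hence "\<forall>\<^sub>F z in nhds x. G z \<noteq> 0" by (rule tendsto_imp_eventually_ne[OF _ G0])
  hence "\<forall>\<^sub>F z in nhds x. H z / G z = p2 z"
    by eventually_elim (simp add: HG)
  hence "(p2 has_real_derivative d) (at x)"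
    using d by (subst (asm) DERIV_cong_ev[OF refl _ refl])
  thus thesis by (rule that)
qed

section \<open>Nondegeneracy of the profile\<close>

lemma obtain_peak: obtains x where "p x \<noteq> 0" "p1 x = 0" "\<And>z. \<bar>p z\<bar> \<le> \<bar>p x\<bar>"
  using vanishing_at_infinity_attains_max_abs[OF p p_lim] p_nz by metis

text \<open>At a peak of the envelope \<open>y1\<close> vanishes only at the crests \<open>\<phi> = \<plusminus> \<pi>/2\<close>.  Between the crests the
equation can be solved for \<open>F'''\<close>, and it is a second-order equation for \<open>F'\<close> along the phase, with
zero initial values at \<open>\<phi> = 0\<close>.\<close>

lemma profile_flat_at_zero_imp_flat:
  assumes x: "p x \<noteq> 0" "p1 x = 0" and d: "(p2 has_real_derivative d) (at x)"
    and zero: "F1 0 = 0" "F2 0 = 0" and \<phi>: "\<bar>\<phi>\<bar> < pi / 2"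
  shows "F1 (y x \<phi>) = 0"
proof (rule linear_system_unique_zero[where g = "\<lambda>\<phi>. F1 (y x \<phi>)" and h = "\<lambda>\<phi>. F2 (y x \<phi>)"
      and l = "- \<bar>\<phi>\<bar>" and r = "\<bar>\<phi>\<bar>" and z = 0 and A = "\<lambda>\<phi>. p x * cos \<phi>"
      and C = "\<lambda>\<phi>. - (yt x \<phi> + y3 d x \<phi> + 2 * F1 (y x \<phi>) ^ (q - 1) * y1 x \<phi> ^ q) / (a * (y1 x \<phi>)\<^sup>2)"
      and D = "\<lambda>\<phi>. - (3 * y2 x \<phi>) / (a * y1 x \<phi>)"])
  have y1: "y1 x \<psi> = a * p x * cos \<psi>" for \<psi> unfolding y1_def by (simp add: x)
  have y1_nz: "y1 x \<psi> \<noteq> 0" if "\<psi> \<in> {- \<bar>\<phi>\<bar>..\<bar>\<phi>\<bar>}" for \<psi>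
  proof -
    have "cos \<psi> > 0" using that \<phi> by (intro cos_gt_zero_pi) auto
    thus ?thesis using y1 x a_pos by simp
  qed
  have dy: "(y x has_real_derivative p x * cos \<psi>) (at \<psi>)" for \<psi>
    unfolding y_def by (auto intro!: derivative_eq_intros)
  fix \<psi> assume \<psi>: "\<psi> \<in> {- \<bar>\<phi>\<bar>..\<bar>\<phi>\<bar>}"
  show "((\<lambda>\<phi>. F1 (y x \<phi>)) has_real_derivative p x * cos \<psi> * F2 (y x \<psi>)) (at \<psi>)"
    by (rule DERIV_cong[OF DERIV_chain2[OF F1 dy]]) simp
  \<comment> \<open>One factor of the nonlinear term is kept as the unknown \<open>F'\<close>; the rest goes into the coefficient.\<close>
  have q: "F1 (y x \<psi>) ^ q = F1 (y x \<psi>) * F1 (y x \<psi>) ^ (q - 1)"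
    using q_ge by (metis One_nat_def Suc_pred gr0I not_numeral_le_zero power_Suc)
  have "F3 (y x \<psi>) * y1 x \<psi> / a * (a * (y1 x \<psi>)\<^sup>2) = F3 (y x \<psi>) * (y1 x \<psi>) ^ 3"
    using a_pos by (simp add: power2_eq_square power3_eq_cube)
  also have "\<dots> = - (yt x \<psi> + y3 d x \<psi> + 2 * F1 (y x \<psi>) ^ (q - 1) * y1 x \<psi> ^ q) * F1 (y x \<psi>)
      - 3 * y2 x \<psi> * F2 (y x \<psi>) * y1 x \<psi>"
    using residual_zero[OF d, of \<psi>] q unfolding residual_def
    by (simp add: power_mult_distrib algebra_simps)
  also have "\<dots> = (- (yt x \<psi> + y3 d x \<psi> + 2 * F1 (y x \<psi>) ^ (q - 1) * y1 x \<psi> ^ q) / (a * (y1 x \<psi>)\<^sup>2) * F1 (y x \<psi>)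
      + - (3 * y2 x \<psi>) / (a * y1 x \<psi>) * F2 (y x \<psi>)) * (a * (y1 x \<psi>)\<^sup>2)"
    using a_pos y1_nz[OF \<psi>] by (simp add: field_simps power2_eq_square)
  finally have "F3 (y x \<psi>) * y1 x \<psi> / a =
      - (yt x \<psi> + y3 d x \<psi> + 2 * F1 (y x \<psi>) ^ (q - 1) * y1 x \<psi> ^ q) / (a * (y1 x \<psi>)\<^sup>2) * F1 (y x \<psi>)
      + - (3 * y2 x \<psi>) / (a * y1 x \<psi>) * F2 (y x \<psi>)"
    using a_pos y1_nz[OF \<psi>] by (subst (asm) mult_right_cancel) auto
  moreover have "F3 (y x \<psi>) * y1 x \<psi> / a = F3 (y x \<psi>) * (p x * cos \<psi>)"
    using a_pos by (simp add: y1)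
  ultimately show "((\<lambda>\<phi>. F2 (y x \<phi>)) has_real_derivative
      - (yt x \<psi> + y3 d x \<psi> + 2 * F1 (y x \<psi>) ^ (q - 1) * y1 x \<psi> ^ q) / (a * (y1 x \<psi>)\<^sup>2) * F1 (y x \<psi>)
      + - (3 * y2 x \<psi>) / (a * y1 x \<psi>) * F2 (y x \<psi>)) (at \<psi>)"
    using DERIV_chain2[OF F2 dy, of \<psi>] by simp
next
  have y1_nz: "\<forall>\<psi>\<in>{- \<bar>\<phi>\<bar>..\<bar>\<phi>\<bar>}. a * (p x * cos \<psi>) \<noteq> 0"
  proof
    fix \<psi> assume "\<psi> \<in> {- \<bar>\<phi>\<bar>..\<bar>\<phi>\<bar>}"
    hence "cos \<psi> > 0" using \<phi> by (intro cos_gt_zero_pi) auto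
    thus "a * (p x * cos \<psi>) \<noteq> 0" using x a_pos by simp
  qed
  have cF: "continuous_on S (\<lambda>\<psi>. F1 (p x * sin \<psi>))" for S
    by (intro continuous_at_imp_continuous_on ballI isCont_o2[OF _ isCont_F1] continuous_intros)
  show "continuous_on {- \<bar>\<phi>\<bar>..\<bar>\<phi>\<bar>} (\<lambda>\<phi>. p x * cos \<phi>)" by (intro continuous_intros)
  show "continuous_on {- \<bar>\<phi>\<bar>..\<bar>\<phi>\<bar>} (\<lambda>\<phi>. - (yt x \<phi> + y3 d x \<phi> +
      2 * F1 (y x \<phi>) ^ (q - 1) * y1 x \<phi> ^ q) / (a * (y1 x \<phi>)\<^sup>2))"
    unfolding y_def y1_def yt_def y3_def x(2)
    by (intro continuous_intros cF) (use y1_nz in auto)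
  show "continuous_on {- \<bar>\<phi>\<bar>..\<bar>\<phi>\<bar>} (\<lambda>\<phi>. - (3 * y2 x \<phi>) / (a * y1 x \<phi>))"
    unfolding y1_def y2_def x(2) by (intro continuous_intros) (use y1_nz in auto)
qed (use zero in \<open>auto simp: y_def\<close>)

text \<open>Otherwise \<open>F'\<close> vanishes on all of \<open>[- max \<bar>p\<bar>, max \<bar>p\<bar>]\<close>, which contains every value of \<open>y\<close>, and the
wave is zero.  Where \<open>F'(w) \<noteq> 0\<close>, the envelope has the third derivative that the previous lemma
asks for, so the argument runs by contradiction.\<close>

lemma profile_nondegenerate: "F1 0 \<noteq> 0 \<or> F2 0 \<noteq> 0"
proof (rule ccontr)
  assume "\<not> ?thesis"
  hence zero: "F1 0 = 0" "F2 0 = 0" by auto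
  obtain x where x: "p x \<noteq> 0" "p1 x = 0" and mx: "\<And>z. \<bar>p z\<bar> \<le> \<bar>p x\<bar>" using obtain_peak by blast
  have flat: "F1 w = 0" if wp: "\<bar>w\<bar> \<le> \<bar>p x\<bar>" for w
  proof (rule ccontr)
    assume w: "F1 w \<noteq> 0"
    hence "w \<noteq> 0" using zero by auto
    then obtain d where d: "(p2 has_real_derivative d) (at x)"
      using p2_differentiable[OF _ wp w] by blast
    have zero_inside: "F1 v = 0" if "v \<in> {- \<bar>p x\<bar><..<\<bar>p x\<bar>}" for v
    proof -
      have "\<bar>v\<bar> < \<bar>p x\<bar>" using that by auto
      hence "\<bar>v / p x\<bar> < 1" using x by (simp add: divide_less_eq)
      hence v: "- 1 < v / p x" "v / p x < 1" by linarith+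
      have "\<bar>arcsin (v / p x)\<bar> < pi / 2" using arcsin_lt_bounded[OF v] by linarith
      from profile_flat_at_zero_imp_flat[OF x d zero this] show ?thesis
        using v x by (simp add: y_def)
    qed
    have cont: "continuous_on (closure {- \<bar>p x\<bar><..<\<bar>p x\<bar>}) F1"
      by (intro continuous_at_imp_continuous_on ballI isCont_F1)
    have "w \<in> closure {- \<bar>p x\<bar><..<\<bar>p x\<bar>}"
      using x wp by (subst closure_greaterThanLessThan) auto
    from continuous_constant_on_closure[OF cont zero_inside this] have "F1 w = 0" .
    with w show False ..
  qed
  obtain z \<phi> where z: "u0 z \<phi> \<noteq> 0" using nontrivial by blast
  have "\<bar>p z\<bar> * \<bar>sin \<phi>\<bar> \<le> \<bar>p x\<bar> * 1" using mx by (intro mult_mono) auto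
  hence "\<bar>y z \<phi>\<bar> \<le> \<bar>p x\<bar>" by (simp add: y_def abs_mult)
  from flat[OF this] z show False by (simp add: u0_def)
qed

lemma p2_has_derivative:
  assumes px: "p x \<noteq> 0"
  obtains d where "(p2 has_real_derivative d) (at x)"
proof -
  have "\<exists>w. w \<noteq> 0 \<and> \<bar>w\<bar> \<le> \<bar>p x\<bar> \<and> F1 w \<noteq> 0"
  proof (rule ccontr)
    assume "\<not> ?thesis"
    hence flat: "F1 w = 0" if "w \<noteq> 0" "\<bar>w\<bar> \<le> \<bar>p x\<bar>" for w using that by blast
    have ev: "\<forall>\<^sub>F w in at 0. F1 w = 0"
      unfolding eventually_at by (rule exI[of _ "\<bar>p x\<bar>"]) (use px flat in \<open>auto simp: dist_real_def\<close>)
    have "(F1 \<longlongrightarrow> F1 0) (at 0)" using isCont_F1 unfolding isCont_def .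
    moreover have "(F1 \<longlongrightarrow> 0) (at 0)" using ev by (rule tendsto_eventually)
    ultimately have F10: "F1 0 = 0" by (rule LIM_unique)
    hence "\<forall>\<^sub>F w in nhds 0. F1 w = 0"
      using ev by (simp add: eventually_nhds_conv_at)
    hence "((\<lambda>w. 0) has_real_derivative F2 0) (at 0)"
      using F1[of 0] by (subst (asm) DERIV_cong_ev[OF refl _ refl])
    hence "F2 0 = 0" by (rule DERIV_unique) auto
    with F10 profile_nondegenerate show False by simp
  qed
  thus thesis using p2_differentiable that by metis
qed

lemma obtain_slope: obtains x where "p x \<noteq> 0" "p1 x \<noteq> 0"
proof (rule ccontr)
  assume "\<not> thesis"
  hence *: "p x * p1 x = 0" for x using that by auto
  have "((\<lambda>x. (p x)\<^sup>2) has_real_derivative 0) (at x)" for x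
    using p[of x] *[of x] by (auto intro!: derivative_eq_intros)
  then obtain c where c: "\<And>x. (p x)\<^sup>2 = c" using DERIV_isconst_all[of "\<lambda>x. (p x)\<^sup>2"] by blast
  have "((\<lambda>x. (p x)\<^sup>2) \<longlongrightarrow> 0\<^sup>2) at_infinity" by (intro tendsto_power p_lim)
  from tendsto_mono[OF at_top_le_at_infinity this] have "c = 0" unfolding c by (simp add: tendsto_const_iff)
  with c p_nz show False by simp
qed

section \<open>The equation at the nodes of the phase\<close>

text \<open>At the nodes \<open>y = 0\<close>, and passing from one to the other changes the sign of the terms odd in
\<open>cos \<phi>\<close>.\<close>

lemma residual_at_0_and_pi:
  assumes "(p2 has_real_derivative d) (at x)"
  shows "F1 0 * (a * m * p x + 3 * a * p2 x - a ^ 3 * p x) + 6 * a\<^sup>2 * F2 0 * p x * p1 x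
          + F3 0 * (a * p x) ^ 3 + 2 * (F1 0 * a * p x) ^ q = 0"
    and "- F1 0 * (a * m * p x + 3 * a * p2 x - a ^ 3 * p x) + 6 * a\<^sup>2 * F2 0 * p x * p1 x
          - F3 0 * (a * p x) ^ 3 + 2 * (- (F1 0 * a * p x)) ^ q = 0"
  using residual_zero[OF assms, of 0] residual_zero[OF assms, of pi]
  unfolding residual_def y_def y1_def y2_def y3_def yt_def
  by (simp_all add: algebra_simps power2_eq_square)

text \<open>For even \<open>q\<close> the sum of the two node equations relates \<open>F''(0) p p'\<close> to \<open>(F'(0) a p)\<^sup>q\<close>.  At a peak
\<open>p' = 0\<close>, so \<open>F'(0) = 0\<close>; at a point with \<open>p p' \<noteq> 0\<close> also \<open>F''(0) = 0\<close>.\<close>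

lemma odd_power: "odd q"
proof
  assume q: "even q"
  have *: "12 * a\<^sup>2 * F2 0 * p x * p1 x + 4 * (F1 0 * a * p x) ^ q = 0" if px: "p x \<noteq> 0" for x
  proof -
    obtain d where d: "(p2 has_real_derivative d) (at x)" using p2_has_derivative[OF px] .
    show ?thesis using residual_at_0_and_pi[OF d] q by (simp add: power_minus_even algebra_simps)
  qed
  obtain x where x: "p x \<noteq> 0" "p1 x = 0" using obtain_peak by blast
  have "(F1 0 * a * p x) ^ q = 0" using *[OF x(1)] x(2) by simp
  hence b: "F1 0 = 0" using x a_pos by simp
  obtain x where x: "p x \<noteq> 0" "p1 x \<noteq> 0" using obtain_slope .
  have "q \<noteq> 0" using q_ge by simp
  hence "(F1 0 * a * p x) ^ q = 0" by (simp add: b)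
  hence "12 * a\<^sup>2 * F2 0 * p x * p1 x = 0" using *[OF x(1)] by linarith
  hence "F2 0 = 0" using x a_pos by simp
  with b profile_nondegenerate show False by simp
qed

lemma F2_0: "F2 0 = 0"
proof -
  obtain x where x: "p x \<noteq> 0" "p1 x \<noteq> 0" using obtain_slope .
  obtain d where d: "(p2 has_real_derivative d) (at x)" using p2_has_derivative[OF x(1)] .
  have cancel: "Z = 0" if "A + Z + B + 2 * C = 0" "- A + Z - B + 2 * - C = 0" for A B C Z :: real
    using that by linarith
  have "6 * a\<^sup>2 * F2 0 * p x * p1 x = 0"
    using residual_at_0_and_pi[OF d]
    unfolding power_minus_odd[OF odd_power] mult_minus_left by (rule cancel)
  thus ?thesis using x a_pos by simp
qed

lemma F1_0: "F1 0 \<noteq> 0"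
  using profile_nondegenerate F2_0 by simp

text \<open>With \<open>F''(0) = 0\<close>, this is the equation at the node \<open>\<phi> = 0\<close>.\<close>

lemma p_ode_odd_power:
  assumes px: "p x \<noteq> 0"
  shows "F1 0 * (3 * p2 x + (m - a\<^sup>2) * p x) + F3 0 * a\<^sup>2 * p x ^ 3
    + 2 * F1 0 ^ q * a ^ (q - 1) * p x ^ q = 0"
proof -
  obtain d where d: "(p2 has_real_derivative d) (at x)" using p2_has_derivative[OF px] .
  have q: "a ^ q = a * a ^ (q - 1)" using q_ge by (metis One_nat_def Suc_pred gr0I not_numeral_le_zero power_Suc)
  have "a * (F1 0 * (3 * p2 x + (m - a\<^sup>2) * p x) + F3 0 * a\<^sup>2 * p x ^ 3
    + 2 * F1 0 ^ q * a ^ (q - 1) * p x ^ q) = 0"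
    using residual_at_0_and_pi(1)[OF d]
    by (simp add: F2_0 power_mult_distrib q algebra_simps power2_eq_square power3_eq_cube)
  thus ?thesis using a_pos by simp
qed

text \<open>The terms are sorted by powers of \<open>cos \<phi> = \<plusminus> 1\<close>, so that the contribution of \<open>F''''(0)\<close>, which is
even, can be cancelled between the two nodes.\<close>

lemma residual_derivative_at_node:
  assumes s: "sin \<phi> = 0"
  shows "(residual q d x has_real_derivative
      cos \<phi> * (F1 0 * (d - 3 * a\<^sup>2 * p1 x)) + cos \<phi> ^ 3 * (9 * F3 0 * a\<^sup>2 * (p x)\<^sup>2 * p1 x)
    + cos \<phi> ^ 4 * (F4 0 * p x * (a * p x) ^ 3)
    + 2 * q * (F1 0 * (a * p x * cos \<phi>)) ^ (q - 1) * (F1 0 * (p1 x * cos \<phi>))) (at \<phi>)"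
proof -
  have dy: "(y x has_real_derivative p x * cos \<phi>) (at \<phi>)"
    unfolding y_def by (auto intro!: derivative_eq_intros)
  have dy1: "(y1 x has_real_derivative p1 x * cos \<phi>) (at \<phi>)"
    unfolding y1_def using s by (auto intro!: derivative_eq_intros)
  have dy2: "(y2 x has_real_derivative p2 x * cos \<phi> - a\<^sup>2 * p x * cos \<phi>) (at \<phi>)"
    unfolding y2_def using s by (auto intro!: derivative_eq_intros)
  have dy3: "(y3 d x has_real_derivative d * cos \<phi> - 3 * a\<^sup>2 * p1 x * cos \<phi>) (at \<phi>)"
    unfolding y3_def using s by (auto intro!: derivative_eq_intros)
  have dyt: "(yt x has_real_derivative 0) (at \<phi>)"
    unfolding yt_def using s by (auto intro!: derivative_eq_intros)
  have val: "y x \<phi> = 0" "y1 x \<phi> = a * p x * cos \<phi>" "y2 x \<phi> = 2 * a * p1 x * cos \<phi>"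
    unfolding y_def y1_def y2_def s by simp_all
  note dF = DERIV_chain2[OF F1 dy] DERIV_chain2[OF F2 dy] DERIV_chain2[OF F3 dy]
  have "((\<lambda>\<phi>. residual q d x \<phi>) has_real_derivative
      F2 0 * (p x * cos \<phi>) * (yt x \<phi> + y3 d x \<phi>) + F1 0 * (d * cos \<phi> - 3 * a\<^sup>2 * p1 x * cos \<phi>)
    + (3 * (F3 0 * (p x * cos \<phi>)) * (a * p x * cos \<phi>) * (2 * a * p1 x * cos \<phi>) + 3 * F2 0 * (p1 x * cos \<phi>) * (2 * a * p1 x * cos \<phi>)
       + 3 * F2 0 * (a * p x * cos \<phi>) * (p2 x * cos \<phi> - a\<^sup>2 * p x * cos \<phi>))
    + (F4 0 * (p x * cos \<phi>) * (a * p x * cos \<phi>) ^ 3 + F3 0 * (3 * (a * p x * cos \<phi>)\<^sup>2 * (p1 x * cos \<phi>)))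
    + 2 * (q * (F1 0 * (a * p x * cos \<phi>)) ^ (q - 1)
        * (F2 0 * (p x * cos \<phi>) * (a * p x * cos \<phi>) + F1 0 * (p1 x * cos \<phi>)))) (at \<phi>)"
    unfolding residual_def
    by (rule derivative_eq_intros dF dy1 dy2 dy3 dyt refl)+ (simp only: val, simp add: algebra_simps)
  thus ?thesis by (rule DERIV_cong) (simp add: F2_0 algebra_simps power2_eq_square power3_eq_cube power4_eq_xxxx)
qed

lemma p_ode_third_order:
  assumes d: "(p2 has_real_derivative d) (at x)"
  shows "F1 0 * (d - 3 * a\<^sup>2 * p1 x) + 9 * F3 0 * a\<^sup>2 * (p x)\<^sup>2 * p1 x
    + 2 * q * F1 0 ^ q * a ^ (q - 1) * p x ^ (q - 1) * p1 x = 0"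
proof -
  have "residual q d x = (\<lambda>_. 0)" using residual_zero[OF d] by auto
  hence zero: "(residual q d x has_real_derivative 0) (at \<phi>)" for \<phi> by simp
  have q: "F1 0 ^ q = F1 0 * F1 0 ^ (q - 1)"
    using q_ge by (metis One_nat_def Suc_pred gr0I not_numeral_le_zero power_Suc)
  have ev: "(- z) ^ (q - Suc 0) = z ^ (q - Suc 0)" for z :: real
    using odd_power by (intro power_minus_even) simp
  note E = DERIV_unique[OF residual_derivative_at_node zero]
  have "F1 0 * (d - 3 * a\<^sup>2 * p1 x) + 9 * F3 0 * a\<^sup>2 * (p x)\<^sup>2 * p1 x
    + F4 0 * p x * (a * p x) ^ 3 + 2 * q * (F1 0 * (a * p x)) ^ (q - 1) * (F1 0 * p1 x) = 0"
    using E[of 0] by simp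
  moreover have "- (F1 0 * (d - 3 * a\<^sup>2 * p1 x)) - 9 * F3 0 * a\<^sup>2 * (p x)\<^sup>2 * p1 x
    + F4 0 * p x * (a * p x) ^ 3 - 2 * q * (F1 0 * (a * p x)) ^ (q - 1) * (F1 0 * p1 x) = 0"
    using E[of pi] by (simp add: ev)
  ultimately have "F1 0 * (d - 3 * a\<^sup>2 * p1 x) + 9 * F3 0 * a\<^sup>2 * (p x)\<^sup>2 * p1 x
     + 2 * q * (F1 0 * (a * p x)) ^ (q - 1) * (F1 0 * p1 x) = 0" by linarith
  thus ?thesis by (simp add: q power_mult_distrib mult_ac)
qed

text \<open>The third-order relation, multiplied by \<open>3\<close>, minus the derivative of \<open>p_ode_odd_power\<close>: this removes \<open>p'''\<close> and
leaves \<open>p'\<close> as a common factor.\<close>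

lemma amplitude_polynomial:
  assumes px: "p x \<noteq> 0" "p1 x \<noteq> 0"
  shows "F1 0 * (- 8 * a\<^sup>2 - m) + 24 * F3 0 * a\<^sup>2 * (p x)\<^sup>2
    + 4 * q * F1 0 ^ q * a ^ (q - 1) * p x ^ (q - 1) = 0"
proof -
  obtain d where d: "(p2 has_real_derivative d) (at x)" using p2_has_derivative[OF px(1)] .
  define L where "L = (\<lambda>x. F1 0 * (3 * p2 x + (m - a\<^sup>2) * p x) + F3 0 * a\<^sup>2 * p x ^ 3
    + 2 * F1 0 ^ q * a ^ (q - 1) * p x ^ q)"
  have "(L has_real_derivative F1 0 * (3 * d + (m - a\<^sup>2) * p1 x) + F3 0 * a\<^sup>2 * (3 * (p x)\<^sup>2 * p1 x)
    + 2 * F1 0 ^ q * a ^ (q - 1) * (q * p x ^ (q - 1) * p1 x)) (at x)"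
    unfolding L_def using d p[of x]
    by (auto intro!: derivative_eq_intros simp: algebra_simps power2_eq_square)
  moreover have "\<forall>\<^sub>F z in nhds x. p z \<noteq> 0"
    using isCont_p[of x] px(1) by (intro tendsto_imp_eventually_ne[where c = "p x"])
      (simp_all add: isCont_def tendsto_at_iff_tendsto_nhds)
  hence "\<forall>\<^sub>F z in nhds x. L z = 0"
    by eventually_elim (unfold L_def, rule p_ode_odd_power)
  hence "(L has_real_derivative 0) (at x)"
    by (subst DERIV_cong_ev[OF refl _ refl]) auto
  ultimately have "F1 0 * (3 * d + (m - a\<^sup>2) * p1 x) + F3 0 * a\<^sup>2 * (3 * (p x)\<^sup>2 * p1 x)
    + 2 * F1 0 ^ q * a ^ (q - 1) * (q * p x ^ (q - 1) * p1 x) = 0" by (rule DERIV_unique)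
  moreover define X where "X = q * F1 0 ^ q * a ^ (q - 1) * p x ^ (q - 1)"
  ultimately have "F1 0 * (3 * d + (m - a\<^sup>2) * p1 x) + 3 * F3 0 * a\<^sup>2 * (p x)\<^sup>2 * p1 x + 2 * X * p1 x = 0"
    by (simp add: mult_ac)
  moreover have "F1 0 * (d - 3 * a\<^sup>2 * p1 x) + 9 * F3 0 * a\<^sup>2 * (p x)\<^sup>2 * p1 x + 2 * X * p1 x = 0"
    using p_ode_third_order[OF d] by (simp add: X_def mult_ac)
  ultimately have "p1 x * (F1 0 * (- 8 * a\<^sup>2 - m) + 24 * F3 0 * a\<^sup>2 * (p x)\<^sup>2 + 4 * X) = 0"
    by algebra
  thus ?thesis using px by (simp add: X_def mult_ac)
qed

text \<open>Near a point with \<open>p p' \<noteq> 0\<close> the envelope is injective.\<close>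

lemma infinite_amplitudes: "infinite {p x |x. p x \<noteq> 0 \<and> p1 x \<noteq> 0}"
proof
  assume fin: "finite {p x |x. p x \<noteq> 0 \<and> p1 x \<noteq> 0}"
  obtain x where x: "p x \<noteq> 0" "p1 x \<noteq> 0" using obtain_slope .
  have "\<forall>\<^sub>F z in nhds x. p z \<noteq> 0" "\<forall>\<^sub>F z in nhds x. p1 z \<noteq> 0"
    using isCont_p[of x] isCont_p1[of x] x
    by (auto intro!: tendsto_imp_eventually_ne simp: isCont_def tendsto_at_iff_tendsto_nhds)
  hence "\<forall>\<^sub>F z in nhds x. p z \<noteq> 0 \<and> p1 z \<noteq> 0" by eventually_elim simp
  then obtain e where e: "e > 0" "\<And>z. dist z x < e \<Longrightarrow> p z \<noteq> 0 \<and> p1 z \<noteq> 0"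
    unfolding eventually_nhds_metric by blast
  define I where "I = {x - e<..<x + e}"
  have I: "p z \<noteq> 0" "p1 z \<noteq> 0" if "z \<in> I" for z
    using e(2)[of z] that by (simp_all add: I_def dist_real_def abs_less_iff)
  have neq: "p u \<noteq> p v" if uv: "u \<in> I" "v \<in> I" "u < v" for u v
  proof
    assume "p u = p v"
    moreover obtain z where "u < z" "z < v" "p v - p u = (v - u) * p1 z"
      using MVT2[OF uv(3), of p p1] p by blast
    ultimately have "p1 z = 0" "z \<in> I" using uv by (auto simp: I_def)
    with I show False by blast
  qed
  hence "inj_on p I" by (intro inj_onI) (metis linorder_neqE)
  moreover have "infinite I" unfolding I_def using e by simp
  ultimately have "infinite (p ` I)" using finite_imageD by blast
  moreover have "p ` I \<subseteq> {p x |x. p x \<noteq> 0 \<and> p1 x \<noteq> 0}" using I by blast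
  ultimately show False using fin finite_subset by blast
qed

text \<open>The amplitude polynomial has infinitely many roots, so it is zero.  Its top term, of degree
\<open>q - 1\<close>, has a nonzero coefficient and can be cancelled only by the quadratic term.\<close>

lemma power_is_3: "q = 3"
  and velocity: "m = - 8 * a\<^sup>2"
  and F3_0: "F3 0 = - (F1 0 ^ 3) / 2"
proof -
  \<comment> \<open>For \<open>q = 3\<close> the last two monomials have the same degree.\<close>
  define P where "P = monom (F1 0 * (- 8 * a\<^sup>2 - m)) 0 + monom (24 * F3 0 * a\<^sup>2) 2
    + monom (4 * q * F1 0 ^ q * a ^ (q - 1)) (q - 1)"
  have "{p x |x. p x \<noteq> 0 \<and> p1 x \<noteq> 0} \<subseteq> {z. poly P z = 0}"
    using amplitude_polynomial by (auto simp: P_def poly_monom)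
  with infinite_amplitudes have "infinite {z. poly P z = 0}" using finite_subset by blast
  hence "P = 0" using poly_roots_finite[of P] by blast
  hence c: "coeff P k = 0" for k by simp
  have "q \<noteq> 2" using odd_power by auto
  hence q3: "q \<ge> 3" using q_ge by simp
  show q: "q = 3"
  proof (rule ccontr)
    assume "q \<noteq> 3"
    hence "coeff P (q - 1) = 4 * q * F1 0 ^ q * a ^ (q - 1)" using q3 by (simp add: P_def)
    thus False using c F1_0 a_pos q3 by simp
  qed
  show "m = - 8 * a\<^sup>2" using c[of 0] F1_0 by (simp add: P_def q)
  have "a\<^sup>2 * (24 * F3 0 + 12 * F1 0 ^ 3) = 0" using c[of 2] by (simp add: P_def q algebra_simps)
  thus "F3 0 = - (F1 0 ^ 3) / 2" using a_pos by simp
qed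

section \<open>Envelope and profile of the cubic breather\<close>

lemma p_ode: "p2 x = 3 * a\<^sup>2 * p x - (F1 0)\<^sup>2 * a\<^sup>2 * p x ^ 3 / 2" if "p x \<noteq> 0"
proof -
  have "F1 0 * (3 * (p2 x - 3 * a\<^sup>2 * p x + (F1 0)\<^sup>2 * a\<^sup>2 * p x ^ 3 / 2)) = 0"
    using p_ode_odd_power[OF that] unfolding power_is_3 velocity F3_0
    by (simp add: algebra_simps power2_eq_square power3_eq_cube)
  thus ?thesis using F1_0 by simp
qed

text \<open>The energy is conserved and tends to \<open>0\<close> at infinity.  The equation for \<open>p''\<close> is known only where
\<open>p \<noteq> 0\<close>; a zero of \<open>p\<close> with \<open>p' \<noteq> 0\<close> is isolated and the equation extends to it by continuity,
and at a zero with \<open>p' = 0\<close> the energy is stationary anyway.\<close>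

lemma energy_zero: "(p1 x)\<^sup>2 = 3 * a\<^sup>2 * (p x)\<^sup>2 - (F1 0)\<^sup>2 * a\<^sup>2 * p x ^ 4 / 4"
proof -
  define G where "G = (\<lambda>x. p2 x - 3 * a\<^sup>2 * p x + (F1 0)\<^sup>2 * a\<^sup>2 * p x ^ 3 / 2)"
  have G: "G x = 0" if "p x \<noteq> 0" for x using p_ode[OF that] by (simp add: G_def)
  have contG: "isCont G x" for x unfolding G_def by (intro continuous_intros isCont_p p2) auto
  have zero: "p1 x * G x = 0" for x
  proof (cases "p x = 0 \<and> p1 x \<noteq> 0")
    case True
    have "((\<lambda>z. (p z - p x) / (z - x)) \<longlongrightarrow> p1 x) (at x)"
      using p[of x] by (simp add: has_field_derivative_iff)
    hence "\<forall>\<^sub>F z in at x. (p z - p x) / (z - x) \<noteq> 0"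
      using True by (intro tendsto_imp_eventually_ne[where c = "p1 x"]) auto
    hence "\<forall>\<^sub>F z in at x. G z = 0" by eventually_elim (use True G in auto)
    hence "(G \<longlongrightarrow> 0) (at x)" by (rule tendsto_eventually)
    moreover have "(G \<longlongrightarrow> G x) (at x)" using contG unfolding isCont_def .
    ultimately have "G x = 0" using LIM_unique by blast
    thus ?thesis by simp
  qed (use G in auto)
  define E where "E = (\<lambda>x. (p1 x)\<^sup>2 - 3 * a\<^sup>2 * (p x)\<^sup>2 + (F1 0)\<^sup>2 * a\<^sup>2 * p x ^ 4 / 4)"
  have "(E has_real_derivative 2 * (p1 x * G x)) (at x)" for x
    unfolding E_def G_def using p[of x] p1[of x]
    by (auto intro!: derivative_eq_intros simp: field_simps power2_eq_square power3_eq_cube)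
  hence "(E has_real_derivative 0) (at x)" for x using zero by simp
  hence const: "E z = E x" for z using DERIV_isconst_all[of E] by blast
  have lim0: "(E \<longlongrightarrow> 0\<^sup>2 - 3 * a\<^sup>2 * 0\<^sup>2 + (F1 0)\<^sup>2 * a\<^sup>2 * 0 ^ 4 / 4) at_top"
    unfolding E_def
    by (intro tendsto_intros tendsto_mono[OF at_top_le_at_infinity p_lim]
        tendsto_mono[OF at_top_le_at_infinity p1_lim]) auto
  have "(E \<longlongrightarrow> E x) at_top"
    by (rule tendsto_eventually, rule always_eventually, rule allI, rule const)
  from tendsto_unique[OF trivial_limit_at_top_linorder this lim0] have "E x = 0" by simp
  thus ?thesis by (simp add: E_def)
qed

text \<open>The energy identity gives \<open>\<bar>p'\<bar> \<le> \<surd>3 a \<bar>p\<bar>\<close>, so a zero would spread to the whole line.\<close>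

lemma p_never_zero: "p x \<noteq> 0"
proof
  assume px: "p x = 0"
  obtain z where z: "p z \<noteq> 0" using p_nz by blast
  have "(p z)\<^sup>2 = 0"
  proof (rule gronwall_zero[where N = "\<lambda>x. (p x)\<^sup>2" and N' = "\<lambda>x. 2 * p x * p1 x" and K = "2 * (sqrt 3 * a)"
        and l = "min x z" and r = "max x z" and z = x])
    fix w
    show "((\<lambda>x. (p x)\<^sup>2) has_real_derivative 2 * p w * p1 w) (at w)"
      using p[of w] by (auto intro!: derivative_eq_intros)
    have "(p1 w)\<^sup>2 \<le> (sqrt 3 * a * p w)\<^sup>2"
      unfolding energy_zero by (simp add: power_mult_distrib)
    hence "\<bar>p1 w\<bar> \<le> \<bar>sqrt 3 * a * p w\<bar>" by (simp only: abs_le_square_iff)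
    hence "\<bar>p w\<bar> * \<bar>p1 w\<bar> \<le> \<bar>p w\<bar> * (sqrt 3 * a * \<bar>p w\<bar>)"
      using a_pos by (intro mult_left_mono) (auto simp: abs_mult)
    also have "\<dots> = sqrt 3 * a * (p w)\<^sup>2" by (simp add: power2_eq_square mult_ac flip: abs_mult)
    finally show "\<bar>2 * p w * p1 w\<bar> \<le> 2 * (sqrt 3 * a) * (p w)\<^sup>2"
      by (simp add: abs_mult)
  qed (use px in auto)
  with z show False by simp
qed

text \<open>The function \<open>h = 1 / (F'(0) p)\<close> satisfies \<open>h'' = \<beta>\<^sup>2 h\<close> with \<open>\<beta> = \<surd>3 a\<close>, so it is a combination of
\<open>e\<^sup>\<beta>\<^sup>x\<close> and \<open>e\<^sup>-\<^sup>\<beta>\<^sup>x\<close>.  The vanishing energy fixes the product of the two coefficients to be \<open>1 / 12\<close>;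
they have the same sign and the combination is a translated hyperbolic cosine.\<close>

lemma envelope_sech:
  obtains \<epsilon> x2 where "\<epsilon> = 1 \<or> \<epsilon> = -1"
    "\<And>x. F1 0 * p x = \<epsilon> * (2 * sqrt 3) / cosh (sqrt 3 * a * x + x2)"
proof -
  define \<beta> where "\<beta> = sqrt 3 * a"
  have \<beta>: "\<beta> > 0" "\<beta>\<^sup>2 = 3 * a\<^sup>2" using a_pos by (simp_all add: \<beta>_def power_mult_distrib)
  define h where "h = (\<lambda>x. 1 / (F1 0 * p x))"
  define h1 where "h1 = (\<lambda>x. - p1 x / (F1 0 * (p x)\<^sup>2))"
  have h: "(h has_real_derivative h1 x) (at x)" for x
    unfolding h_def h1_def using p[of x] p_never_zero[of x] F1_0
    by (auto intro!: derivative_eq_intros simp: field_simps power2_eq_square)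
  have h1: "(h1 has_real_derivative \<beta>\<^sup>2 * h x) (at x)" for x
  proof -
    have "(h1 has_real_derivative (2 * (p1 x)\<^sup>2 - p2 x * p x) / (F1 0 * p x ^ 3)) (at x)"
      unfolding h1_def using p[of x] p1[of x] p_never_zero[of x] F1_0
      by (auto intro!: derivative_eq_intros simp: field_simps power2_eq_square power3_eq_cube)
    moreover have "(2 * (p1 x)\<^sup>2 - p2 x * p x) = 3 * a\<^sup>2 * (p x)\<^sup>2"
      unfolding energy_zero p_ode[OF p_never_zero] by (simp add: algebra_simps power2_eq_square power3_eq_cube power4_eq_xxxx)
    ultimately show ?thesis unfolding \<beta> h_def using p_never_zero[of x] F1_0
      by (simp add: field_simps power2_eq_square power3_eq_cube)
  qed
  have const: "(h z + s * h1 z / \<beta>) * exp (- (s * \<beta> * z)) = h 0 + s * h1 0 / \<beta>" if s: "s\<^sup>2 = 1" for s z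
  proof -
    define g where "g = (\<lambda>x. (h x + s * h1 x / \<beta>) * exp (- (s * \<beta> * x)))"
    have "(g has_real_derivative 0) (at x)" for x
    proof -
      have "(g has_real_derivative (h1 x + s * (\<beta>\<^sup>2 * h x) / \<beta>) * exp (- (s * \<beta> * x))
          + (h x + s * h1 x / \<beta>) * (exp (- (s * \<beta> * x)) * - (s * \<beta>))) (at x)"
        unfolding g_def using h[of x] h1[of x] \<beta>(1) by (auto intro!: derivative_eq_intros)
      also have "(h1 x + s * (\<beta>\<^sup>2 * h x) / \<beta>) * exp (- (s * \<beta> * x))
          + (h x + s * h1 x / \<beta>) * (exp (- (s * \<beta> * x)) * - (s * \<beta>))
          = (1 - s\<^sup>2) * h1 x * exp (- (s * \<beta> * x))"
        using \<beta>(1) by (simp add: field_simps power2_eq_square)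
      finally show ?thesis by (simp add: s)
    qed
    hence "g z = g 0" using DERIV_isconst_all[of g] by blast
    thus ?thesis by (simp add: g_def)
  qed
  define c1 where "c1 = h 0 + h1 0 / \<beta>"
  define c2 where "c2 = h 0 - h1 0 / \<beta>"
  have e1: "h x + h1 x / \<beta> = c1 * exp (\<beta> * x)" for x
    using const[of 1 x] by (simp add: c1_def exp_minus field_simps)
  have e2: "h x - h1 x / \<beta> = c2 * exp (- (\<beta> * x))" for x
    using const[of "-1" x] by (simp add: c2_def exp_minus field_simps)
  have hx: "h x = (c1 * exp (\<beta> * x) + c2 * exp (- (\<beta> * x))) / 2" for x
  proof -
    have "2 * h x = (h x + h1 x / \<beta>) + (h x - h1 x / \<beta>)" by simp
    thus ?thesis unfolding e1 e2 by simp
  qed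
  have "12 * (c1 * c2) = 12 * ((h 0)\<^sup>2 - (h1 0)\<^sup>2 / \<beta>\<^sup>2)"
    using \<beta>(1) by (simp add: c1_def c2_def field_simps power2_eq_square)
  also have "(h1 0)\<^sup>2 = (3 * a\<^sup>2 * (p 0)\<^sup>2 - (F1 0)\<^sup>2 * a\<^sup>2 * p 0 ^ 4 / 4) / ((F1 0)\<^sup>2 * p 0 ^ 4)"
    by (simp add: h1_def power_divide energy_zero power_mult_distrib flip: power_mult)
  also have "12 * ((h 0)\<^sup>2 - \<dots> / \<beta>\<^sup>2) = 1"
    unfolding \<beta> h_def using p_never_zero[of 0] F1_0 a_pos
    by (simp add: field_simps power2_eq_square power4_eq_xxxx)
  finally have c12: "12 * (c1 * c2) = 1" .
  hence c1: "c1 \<noteq> 0" by auto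
  define \<epsilon> where "\<epsilon> = sgn c1"
  define x2 where "x2 = ln (2 * sqrt 3 * \<bar>c1\<bar>)"
  have \<epsilon>: "\<epsilon> = 1 \<or> \<epsilon> = -1" using c1 by (auto simp: \<epsilon>_def sgn_if)
  have ex2: "exp x2 = 2 * sqrt 3 * \<bar>c1\<bar>" using c1 by (simp add: x2_def)
  have k1: "2 * sqrt 3 * c1 = \<epsilon> * exp x2" using c1 by (simp add: ex2 \<epsilon>_def sgn_if)
  have "(2 * sqrt 3 * c2) * (2 * sqrt 3 * c1) = 4 * (sqrt 3 * sqrt 3) * (c1 * c2)" by algebra
  hence "(2 * sqrt 3 * c2) * (2 * sqrt 3 * c1) = 1" using c12 by simp
  hence "(2 * sqrt 3 * c2) * \<epsilon> * exp x2 = 1" unfolding k1 by (simp add: mult_ac)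
  hence k2: "2 * sqrt 3 * c2 = \<epsilon> * exp (- x2)" using \<epsilon> by (auto simp: exp_minus field_simps)
  have "F1 0 * p x = \<epsilon> * (2 * sqrt 3) / cosh (sqrt 3 * a * x + x2)" for x
  proof -
    have "2 * sqrt 3 * h x = (\<epsilon> * exp x2 * exp (\<beta> * x) + \<epsilon> * exp (- x2) * exp (- (\<beta> * x))) / 2"
      unfolding hx k1[symmetric] k2[symmetric] by (simp add: algebra_simps add_divide_distrib)
    also have "\<dots> = \<epsilon> * cosh (\<beta> * x + x2)"
      by (simp add: cosh_field_def exp_add[symmetric] mult.assoc add.commute flip: distrib_left)
    finally have "F1 0 * p x * (\<epsilon> * cosh (\<beta> * x + x2)) = 2 * sqrt 3"
      using p_never_zero[of x] F1_0 by (simp add: h_def field_simps)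
    thus ?thesis using \<epsilon> cosh_real_pos[of "\<beta> * x + x2"] by (auto simp: field_simps \<beta>_def)
  qed
  with \<epsilon> show thesis by (rule that)
qed

text \<open>The difference of the equations at the phases \<open>\<phi>\<close> and \<open>\<pi> - \<phi>\<close>, which have the same \<open>y = w\<close>.  The
unknown third derivative \<open>d\<close> of the envelope cancels, and the equations for \<open>p\<close> turn all
coefficients into polynomials in \<open>p\<^sup>2\<close>.\<close>

lemma profile_ode_parametrised:
  assumes w: "\<bar>w\<bar> < \<bar>p x\<bar>"
  shows "(24 * w * F2 w + 8 * w\<^sup>2 * (F3 w + 2 * F1 w ^ 3)) + (p x)\<^sup>2 *
    (- 3 / 2 * (F1 0)\<^sup>2 * F1 w - 3 * (F1 0)\<^sup>2 * w * F2 w + (F3 w + 2 * F1 w ^ 3) * (1 - 3 / 4 * (F1 0)\<^sup>2 * w\<^sup>2)) = 0"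
proof -
  obtain d where d: "(p2 has_real_derivative d) (at x)" using p2_has_derivative[OF p_never_zero] .
  define \<phi> where "\<phi> = arcsin (w / p x)"
  have "\<bar>w / p x\<bar> < 1" using w by (simp add: divide_less_eq)
  hence v: "- 1 < w / p x" "w / p x < 1" by linarith+
  hence s: "sin \<phi> = w / p x" by (simp add: \<phi>_def)
  have "cos \<phi> > 0" unfolding \<phi>_def using arcsin_lt_bounded[OF v] by (intro cos_gt_zero_pi) auto
  have c2: "(cos \<phi>)\<^sup>2 = 1 - (sin \<phi>)\<^sup>2" by (simp add: cos_squared_eq)
  have ps: "w = p x * sin \<phi>" using s p_never_zero[of x] by simp
  have yw: "y x \<phi> = w" "y x (pi - \<phi>) = w" by (simp_all add: y_def ps)
  define b where "b = F1 0"
  have en: "(p1 x)\<^sup>2 = 3 * a\<^sup>2 * (p x)\<^sup>2 - b\<^sup>2 * a\<^sup>2 * p x ^ 4 / 4"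
   and ode: "p2 x = 3 * a\<^sup>2 * p x - b\<^sup>2 * a\<^sup>2 * p x ^ 3 / 2"
    unfolding b_def by (rule energy_zero, rule p_ode[OF p_never_zero])
  have "residual q d x \<phi> - residual q d x (pi - \<phi>) = 0" by (simp add: residual_zero[OF d])
  also have "residual q d x \<phi> - residual q d x (pi - \<phi>) =
     2 * a * cos \<phi> * (F1 w * (m * p x + 3 * p2 x - a\<^sup>2 * p x)
       + 3 * F2 w * sin \<phi> * (2 * (p1 x)\<^sup>2 + p x * (p2 x - a\<^sup>2 * p x))
       + (F3 w + 2 * F1 w ^ 3) * p x * (3 * (p1 x)\<^sup>2 * (sin \<phi>)\<^sup>2 + a\<^sup>2 * (p x)\<^sup>2 * (cos \<phi>)\<^sup>2))"
    unfolding residual_def yw power_is_3 yt_def y1_def y2_def y3_def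
    by (simp add: algebra_simps power2_eq_square power3_eq_cube)
  finally have "F1 w * (m * p x + 3 * p2 x - a\<^sup>2 * p x)
       + 3 * F2 w * sin \<phi> * (2 * (p1 x)\<^sup>2 + p x * (p2 x - a\<^sup>2 * p x))
       + (F3 w + 2 * F1 w ^ 3) * p x * (3 * (p1 x)\<^sup>2 * (sin \<phi>)\<^sup>2 + a\<^sup>2 * (p x)\<^sup>2 * (cos \<phi>)\<^sup>2) = 0"
    using a_pos \<open>cos \<phi> > 0\<close> by simp
  also have "F1 w * (m * p x + 3 * p2 x - a\<^sup>2 * p x)
       + 3 * F2 w * sin \<phi> * (2 * (p1 x)\<^sup>2 + p x * (p2 x - a\<^sup>2 * p x))
       + (F3 w + 2 * F1 w ^ 3) * p x * (3 * (p1 x)\<^sup>2 * (sin \<phi>)\<^sup>2 + a\<^sup>2 * (p x)\<^sup>2 * (cos \<phi>)\<^sup>2)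
    = a\<^sup>2 * p x * ((24 * (p x * sin \<phi>) * F2 w + 8 * (p x * sin \<phi>)\<^sup>2 * (F3 w + 2 * F1 w ^ 3)) + (p x)\<^sup>2 *
    (- 3 / 2 * b\<^sup>2 * F1 w - 3 * b\<^sup>2 * (p x * sin \<phi>) * F2 w
      + (F3 w + 2 * F1 w ^ 3) * (1 - 3 / 4 * b\<^sup>2 * (p x * sin \<phi>)\<^sup>2)))"
    unfolding velocity en ode c2
    by (simp add: field_simps power2_eq_square power3_eq_cube power4_eq_xxxx)
  finally show ?thesis using a_pos p_never_zero[of x] unfolding ps[symmetric] b_def by simp
qed

text \<open>For fixed \<open>v\<close>, two envelope values larger than \<open>\<bar>v\<bar>\<close> make both coefficients in
\<open>profile_ode_parametrised\<close> vanish; eliminating \<open>F'''\<close> gives \<open>((4 + F'(0)\<^sup>2 v\<^sup>2) F'(v))' = 0\<close>.  The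
largest value \<open>Y\<close> of \<open>\<bar>p\<bar>\<close> is reached by continuity.\<close>

lemma profile_slope:
  assumes w: "\<bar>w\<bar> \<le> \<bar>p x\<bar>"
  shows "F1 w * (4 + (F1 0)\<^sup>2 * w\<^sup>2) = 4 * F1 0"
proof -
  obtain \<epsilon> x2 where \<epsilon>: "\<epsilon> = 1 \<or> \<epsilon> = -1"
    and sech: "\<And>x. F1 0 * p x = \<epsilon> * (2 * sqrt 3) / cosh (sqrt 3 * a * x + x2)"
    using envelope_sech by blast
  define Y where "Y = 2 * sqrt 3 / \<bar>F1 0\<bar>"
  have Y: "Y > 0" using F1_0 by (simp add: Y_def)
  have absp: "\<bar>p x\<bar> = Y / cosh (sqrt 3 * a * x + x2)" for x
  proof -
    have "\<bar>F1 0\<bar> * \<bar>p x\<bar> = 2 * sqrt 3 / cosh (sqrt 3 * a * x + x2)"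
      using arg_cong[OF sech[of x], of abs] \<epsilon> by (auto simp: abs_mult)
    thus ?thesis using F1_0 by (simp add: Y_def field_simps)
  qed
  have amplitude: "\<exists>x. \<bar>p x\<bar> = Y / r" if "r \<ge> 1" for r
  proof
    show "\<bar>p ((arcosh r - x2) / (sqrt 3 * a))\<bar> = Y / r"
      unfolding absp using a_pos that by (simp add: cosh_arcosh_real)
  qed
  have ode: "F2 v * (4 + (F1 0)\<^sup>2 * v\<^sup>2) + F1 v * ((F1 0)\<^sup>2 * (2 * v)) = 0" if v: "\<bar>v\<bar> < Y" for v
  proof (cases "v = 0")
    case True
    thus ?thesis by (simp add: F2_0)
  next
    case False
    \<comment> \<open>The envelope values \<open>Y\<close> and \<open>Y / r\<close> are distinct, and both exceed \<open>\<bar>v\<bar>\<close>.\<close>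
    define r where "r = (1 + Y / \<bar>v\<bar>) / 2"
    have "1 < Y / \<bar>v\<bar>" using v False by (simp add: less_divide_eq)
    moreover have "1 < (1 + k) / 2 \<and> (1 + k) / 2 < k" if "1 < k" for k :: real using that by simp
    ultimately have r: "1 < r" "r < Y / \<bar>v\<bar>" unfolding r_def by blast+
    obtain x where x: "\<bar>p x\<bar> = Y" using amplitude[of 1] by auto
    obtain z where z: "\<bar>p z\<bar> = Y / r" using amplitude[of r] r by auto
    have vz: "\<bar>v\<bar> < Y / r" using r False by (simp add: field_simps)
    have "Y / r < Y" using r Y by (simp add: field_simps)
    hence "\<bar>p z\<bar> < \<bar>p x\<bar>" using x z by simp
    hence ne: "(p x)\<^sup>2 \<noteq> (p z)\<^sup>2" by (auto simp: power2_eq_iff)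
    define \<alpha> where "\<alpha> = 24 * v * F2 v + 8 * v\<^sup>2 * (F3 v + 2 * F1 v ^ 3)"
    define \<gamma> where "\<gamma> = - 3 / 2 * (F1 0)\<^sup>2 * F1 v - 3 * (F1 0)\<^sup>2 * v * F2 v
        + (F3 v + 2 * F1 v ^ 3) * (1 - 3 / 4 * (F1 0)\<^sup>2 * v\<^sup>2)"
    have 1: "\<alpha> + (p x)\<^sup>2 * \<gamma> = 0" and 2: "\<alpha> + (p z)\<^sup>2 * \<gamma> = 0"
      unfolding \<alpha>_def \<gamma>_def
      by (rule profile_ode_parametrised, use v x vz z in simp)+
    have "((p x)\<^sup>2 - (p z)\<^sup>2) * \<gamma> = (\<alpha> + (p x)\<^sup>2 * \<gamma>) - (\<alpha> + (p z)\<^sup>2 * \<gamma>)"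
      by (simp add: algebra_simps)
    hence "((p x)\<^sup>2 - (p z)\<^sup>2) * \<gamma> = 0" unfolding 1 2 by simp
    hence \<gamma>: "\<gamma> = 0" using ne by simp
    with 1 have \<alpha>: "\<alpha> = 0" by simp
    have "v * (8 * (3 * F2 v + v * (F3 v + 2 * F1 v ^ 3))) = 0"
      using \<alpha> by (simp add: \<alpha>_def algebra_simps power2_eq_square)
    hence K: "v * (F3 v + 2 * F1 v ^ 3) = - 3 * F2 v" using False by simp
    have "v * \<gamma> = - 3 / 4 * (F2 v * (4 + (F1 0)\<^sup>2 * v\<^sup>2) + F1 v * ((F1 0)\<^sup>2 * (2 * v)))"
    proof -
      have "v * \<gamma> = - 3 / 2 * (F1 0)\<^sup>2 * F1 v * v - 3 * (F1 0)\<^sup>2 * v\<^sup>2 * F2 v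
        + v * (F3 v + 2 * F1 v ^ 3) * (1 - 3 / 4 * (F1 0)\<^sup>2 * v\<^sup>2)"
        by (simp add: \<gamma>_def algebra_simps power2_eq_square)
      thus ?thesis unfolding K by (simp add: algebra_simps)
    qed
    thus ?thesis using \<gamma> by simp
  qed
  define H where "H = (\<lambda>v. F1 v * (4 + (F1 0)\<^sup>2 * v\<^sup>2))"
  have dH: "(H has_real_derivative 0) (at v)" if "\<bar>v\<bar> < Y" for v
    unfolding H_def using ode[OF that]
    by (intro DERIV_cong[OF DERIV_mult[OF F1 DERIV_add[OF DERIV_const DERIV_cmult[OF DERIV_power[OF DERIV_ident]]]]])
       (simp add: algebra_simps)
  have inside: "H v = 4 * F1 0" if v: "v \<in> {- Y<..<Y}" for v
  proof -
    have "H v = H 0"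
      by (rule DERIV_isconst3[of "- Y" Y]) (use v Y in \<open>auto intro!: dH simp: abs_less_iff\<close>)
    thus ?thesis by (simp add: H_def)
  qed
  have cont: "continuous_on (closure {- Y<..<Y}) H"
    unfolding H_def by (intro continuous_at_imp_continuous_on ballI continuous_intros isCont_F1)
  have "\<bar>p x\<bar> \<le> Y" unfolding absp using Y cosh_real_ge_1[of "sqrt 3 * a * x + x2"]
    by (simp add: divide_le_eq)
  hence "w \<in> closure {- Y<..<Y}" using w Y by (subst closure_greaterThanLessThan) auto
  from continuous_constant_on_closure[OF cont inside this] show ?thesis by (simp add: H_def)
qed

text \<open>Here the amplitude \<open>F'(0)\<close> disappears: it occurs only in the product \<open>F'(0) p\<close>.\<close>

lemma explicit_form:
  obtains \<epsilon> x2 where "\<epsilon> = 1 \<or> \<epsilon> = -1"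
    "\<And>t x. ((\<lambda>x. 2 * arctan (\<epsilon> * sqrt 3 * (sin (a * x - 8 * a ^ 3 * t) / cosh (sqrt 3 * a * x + x2))))
       has_real_derivative u0 x (\<theta> t x)) (at x)"
proof -
  obtain \<epsilon> x2 where \<epsilon>: "\<epsilon> = 1 \<or> \<epsilon> = -1"
    and sech: "\<And>x. F1 0 * p x = \<epsilon> * (2 * sqrt 3) / cosh (sqrt 3 * a * x + x2)"
    using envelope_sech by blast
  have "((\<lambda>x. 2 * arctan (\<epsilon> * sqrt 3 * (sin (a * x - 8 * a ^ 3 * t) / cosh (sqrt 3 * a * x + x2))))
       has_real_derivative u0 x (\<theta> t x)) (at x)" for t x
  proof -
    have arg: "\<epsilon> * sqrt 3 * (sin (a * z - 8 * a ^ 3 * t) / cosh (sqrt 3 * a * z + x2))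
        = F1 0 * y z (\<theta> t z) / 2" for z
    proof -
      have "F1 0 * y z (\<theta> t z) = F1 0 * p z * sin (\<theta> t z)" by (simp add: y_def)
      thus ?thesis unfolding sech velocity by (simp add: algebra_simps power2_eq_square power3_eq_cube)
    qed
    have "((\<lambda>x. 2 * arctan (F1 0 * y x (\<theta> t x) / 2)) has_real_derivative u0 x (\<theta> t x)) (at x)"
    proof -
      have "\<bar>p x\<bar> * \<bar>sin (\<theta> t x)\<bar> \<le> \<bar>p x\<bar> * 1" by (intro mult_left_mono) auto
      hence "\<bar>y x (\<theta> t x)\<bar> \<le> \<bar>p x\<bar>" by (simp add: y_def abs_mult)
      from profile_slope[OF this] have sl: "F1 (y x (\<theta> t x)) = 4 * F1 0 / (4 + (F1 0)\<^sup>2 * (y x (\<theta> t x))\<^sup>2)"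
        by (simp add: field_simps add_nonneg_eq_0_iff)
      have "((\<lambda>x. 2 * arctan (F1 0 * y x (\<theta> t x) / 2)) has_real_derivative
          2 * (inverse (1 + (F1 0 * y x (\<theta> t x) / 2)\<^sup>2) * (F1 0 * y1 x (\<theta> t x) / 2))) (at x)"
        by (intro DERIV_cmult DERIV_chain2[OF DERIV_arctan] DERIV_cdivide deriv_y)
      also have "2 * (inverse (1 + (F1 0 * y x (\<theta> t x) / 2)\<^sup>2) * (F1 0 * y1 x (\<theta> t x) / 2)) = u0 x (\<theta> t x)"
      proof -
        have "1 + (F1 0 * y x (\<theta> t x) / 2)\<^sup>2 = (4 + (F1 0)\<^sup>2 * (y x (\<theta> t x))\<^sup>2) / 4"
          by (simp add: power_divide power_mult_distrib)
        thus ?thesis unfolding u0_def sl by (simp add: field_simps)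
      qed
      finally show ?thesis .
    qed
    thus ?thesis unfolding arg .
  qed
  with \<epsilon> show thesis by (rule that)
qed

end

section \<open>Integrating the equation once\<close>

lemma smooth_plane_partials:
  assumes "C_k_plane (Suc k) u"
  obtains ut ux where "\<And>t x. ((\<lambda>s. u s x) has_real_derivative ut t x) (at t)"
    "\<And>t x. (u t has_real_derivative ux t x) (at x)"
    "C_k_plane k ut" "C_k_plane k ux"
  using assms by auto

lemma smooth_plane_has_derivatives:
  assumes u: "smooth_plane u"
  shows "((\<lambda>s. u s x) has_real_derivative deriv (\<lambda>s. u s x) t) (at t)"
    and "(u t has_real_derivative deriv (u t) x) (at x)"
    and "(deriv (u t) has_real_derivative (deriv ^^ 2) (u t) x) (at x)"
    and "((deriv ^^ 2) (u t) has_real_derivative (deriv ^^ 3) (u t) x) (at x)"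
proof -
  have "C_k_plane (Suc (Suc (Suc 0))) u" using u unfolding smooth_plane_def by blast
  then obtain ut ux where 1: "\<And>t x. ((\<lambda>s. u s x) has_real_derivative ut t x) (at t)"
    "\<And>t x. (u t has_real_derivative ux t x) (at x)" "C_k_plane (Suc (Suc 0)) ux"
    by (rule smooth_plane_partials) blast
  from 1(3) obtain uxx where 2: "\<And>t x. (ux t has_real_derivative uxx t x) (at x)" "C_k_plane (Suc 0) uxx"
    by (rule smooth_plane_partials) blast
  from 2(2) obtain uxxx where 3: "\<And>t x. (uxx t has_real_derivative uxxx t x) (at x)"
    by (rule smooth_plane_partials) blast
  have [simp]: "deriv (u t) = ux t" "deriv (ux t) = uxx t" "deriv (uxx t) = uxxx t" for t
    using 1(2) 2(1) 3 by (auto intro!: ext DERIV_imp_deriv)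
  show "((\<lambda>s. u s x) has_real_derivative deriv (\<lambda>s. u s x) t) (at t)"
    using DERIV_imp_deriv[OF 1(1)[of x t]] 1(1)[of x t] by simp
  show "(u t has_real_derivative deriv (u t) x) (at x)"
    "(deriv (u t) has_real_derivative (deriv ^^ 2) (u t) x) (at x)"
    "((deriv ^^ 2) (u t) has_real_derivative (deriv ^^ 3) (u t) x) (at x)"
    using 1(2) 2(1) 3 by (simp_all add: eval_nat_numeral)
qed

context ansatz begin

lemma tendsto_phase_modulated:
  assumes "(f \<longlongrightarrow> 0) Fl" and "\<And>x. \<bar>g x\<bar> \<le> (1::real)"
  shows "((\<lambda>x. f x * g x) \<longlongrightarrow> (0::real)) Fl"
proof (rule Lim_null_comparison)
  show "\<forall>\<^sub>F x in Fl. norm (f x * g x) \<le> \<bar>f x\<bar>"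
    using assms(2) by (intro always_eventually allI) (simp add: abs_mult mult_left_le)
  show "((\<lambda>x. \<bar>f x\<bar>) \<longlongrightarrow> 0) Fl" using tendsto_rabs[OF assms(1)] by simp
qed

lemma tendsto_wave_zero:
  assumes lim: "(p \<longlongrightarrow> 0) Fl" "(p1 \<longlongrightarrow> 0) Fl" "(p2 \<longlongrightarrow> 0) Fl"
  shows "((\<lambda>x. u0 x (\<theta> t x)) \<longlongrightarrow> 0) Fl" "((\<lambda>x. u1 x (\<theta> t x)) \<longlongrightarrow> 0) Fl"
    "((\<lambda>x. F1 (y x (\<theta> t x)) * yt x (\<theta> t x)) \<longlongrightarrow> 0) Fl"
proof -
  have sn: "((\<lambda>x. f x * sin (\<theta> t x)) \<longlongrightarrow> 0) Fl" if "(f \<longlongrightarrow> 0) Fl" for f :: "real \<Rightarrow> real"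
    by (rule tendsto_phase_modulated[OF that]) simp
  have cs: "((\<lambda>x. f x * cos (\<theta> t x)) \<longlongrightarrow> 0) Fl" if "(f \<longlongrightarrow> 0) Fl" for f :: "real \<Rightarrow> real"
    by (rule tendsto_phase_modulated[OF that]) simp
  have cm: "((\<lambda>x. c * f x) \<longlongrightarrow> 0) Fl" if "(f \<longlongrightarrow> 0) Fl" for c and f :: "real \<Rightarrow> real"
    using tendsto_mult_right_zero[OF that] .
  have y: "((\<lambda>x. y x (\<theta> t x)) \<longlongrightarrow> 0) Fl" unfolding y_def by (intro sn lim)
  have y1: "((\<lambda>x. y1 x (\<theta> t x)) \<longlongrightarrow> 0) Fl"
    unfolding y1_def using tendsto_add[OF sn[OF lim(2)] cs[OF cm[OF lim(1)]]] by simp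
  have y2: "((\<lambda>x. y2 x (\<theta> t x)) \<longlongrightarrow> 0) Fl"
    unfolding y2_def
    using tendsto_diff[OF tendsto_add[OF sn[OF lim(3)] cs[OF cm[OF lim(2)]]] sn[OF cm[OF lim(1)]]] by simp
  have yt: "((\<lambda>x. yt x (\<theta> t x)) \<longlongrightarrow> 0) Fl"
    unfolding yt_def using cs[OF cm[OF lim(1)]] by simp
  have F: "((\<lambda>x. F1 (y x (\<theta> t x))) \<longlongrightarrow> F1 0) Fl" "((\<lambda>x. F2 (y x (\<theta> t x))) \<longlongrightarrow> F2 0) Fl"
    by (rule isCont_tendsto_compose[OF isCont_F1 y], rule isCont_tendsto_compose[OF isCont_F2 y])
  show "((\<lambda>x. u0 x (\<theta> t x)) \<longlongrightarrow> 0) Fl"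
    unfolding u0_def using tendsto_mult[OF F(1) y1] by simp
  show "((\<lambda>x. u1 x (\<theta> t x)) \<longlongrightarrow> 0) Fl"
    unfolding u1_def using tendsto_add[OF tendsto_mult[OF F(2) tendsto_power[OF y1, of 2]] tendsto_mult[OF F(1) y2]] by simp
  show "((\<lambda>x. F1 (y x (\<theta> t x)) * yt x (\<theta> t x)) \<longlongrightarrow> 0) Fl"
    using tendsto_mult[OF F(1) yt] by simp
qed

text \<open>\<open>W = v\<^sub>t + u\<^sub>x\<^sub>x + 2 u\<^sup>q\<close> does not depend on \<open>x\<close>.  As \<open>v\<^sub>t\<close> and \<open>u\<close> vanish at infinity, \<open>u\<^sub>x\<^sub>x\<close>
converges to the value of \<open>W\<close>; but \<open>u\<^sub>x\<close> tends to \<open>0\<close>, so this limit is \<open>0\<close>.\<close>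

lemma integrated_equation:
  assumes sol: "gKdV_smooth_solution q (\<lambda>t x. u0 x (\<theta> t x))" and q: "q \<noteq> 0"
    and lim: "(p \<longlongrightarrow> 0) at_top" "(p1 \<longlongrightarrow> 0) at_top" "(p2 \<longlongrightarrow> 0) at_top"
  shows "((\<lambda>x. u1 x (\<theta> t x)) has_real_derivative
         - F1 (y x (\<theta> t x)) * yt x (\<theta> t x) - 2 * u0 x (\<theta> t x) ^ q) (at x)"
proof -
  define u where "u = (\<lambda>t x. u0 x (\<theta> t x))"
  have sm: "smooth_plane u" and eq: "\<And>t x. deriv (\<lambda>s. u s x) t + deriv (\<lambda>y. (deriv ^^ 2) (u t) y + 2 * u t y ^ q) x = 0"
    using sol unfolding gKdV_smooth_solution_def u_def by auto
  note du = smooth_plane_has_derivatives[OF sm]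
  have ux: "deriv (u t) = (\<lambda>x. u1 x (\<theta> t x))" for t
    by (rule ext, rule DERIV_imp_deriv) (simp add: u_def deriv_u0)
  define vt where "vt = (\<lambda>x. F1 (y x (\<theta> t x)) * yt x (\<theta> t x))"
  have vt: "(vt has_real_derivative deriv (\<lambda>s. u s x) t) (at x)" for x
    using du(1)[of x t] unfolding vt_def u_def deriv_v_time_deriv_space .
  define W where "W = (\<lambda>x. vt x + ((deriv ^^ 2) (u t) x + 2 * u t x ^ q))"
  have "(W has_real_derivative 0) (at x)" for x
  proof -
    have "((\<lambda>x. (deriv ^^ 2) (u t) x + 2 * u t x ^ q) has_real_derivative
        (deriv ^^ 3) (u t) x + 2 * (q * u t x ^ (q - 1) * deriv (u t) x)) (at x)"
      using du(2,4)[of t x] by (auto intro!: derivative_eq_intros)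
    from this DERIV_imp_deriv[OF this]
    have "((\<lambda>x. (deriv ^^ 2) (u t) x + 2 * u t x ^ q) has_real_derivative
        deriv (\<lambda>x. (deriv ^^ 2) (u t) x + 2 * u t x ^ q) x) (at x)" by simp
    from DERIV_add[OF vt this] show ?thesis unfolding W_def using eq by simp
  qed
  hence "\<exists>c. \<forall>x. W x = c" using DERIV_isconst_all[of W] by blast
  then obtain c where c: "\<And>x. W x = c" by blast
  note van = tendsto_wave_zero[OF lim, of t]
  have "((\<lambda>x. c - vt x - 2 * u t x ^ q) \<longlongrightarrow> c - 0 - 2 * 0 ^ q) at_top"
    unfolding vt_def u_def by (intro tendsto_intros van)
  moreover have "(deriv ^^ 2) (u t) = (\<lambda>x. c - vt x - 2 * u t x ^ q)"
    using c by (auto simp: W_def algebra_simps)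
  ultimately have "((deriv ^^ 2) (u t) \<longlongrightarrow> c) at_top" using q by (simp add: zero_power)
  from limit_of_derivative_zero[OF du(3) van(2)[folded ux] this] have c0: "c = 0" .
  have "(deriv ^^ 2) (u t) x = - vt x - 2 * u t x ^ q" using c[of x] unfolding c0 W_def by simp
  thus ?thesis using du(3)[of t x] unfolding ux by (simp add: vt_def u_def)
qed

text \<open>The energy \<open>u\<^sub>x\<^sup>2 + 4 u\<^sup>q\<^sup>+\<^sup>1 / (q + 1)\<close> is constant and decays, so it is zero.  At a maximum of \<open>\<bar>u\<bar>\<close>
this says \<open>u = 0\<close>.\<close>

lemma stationary_trivial:
  assumes q: "q \<noteq> 0"
    and eq: "\<And>x. ((\<lambda>x. u1 x (\<theta> t x)) has_real_derivative - 2 * u0 x (\<theta> t x) ^ q) (at x)"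
    and lim: "((\<lambda>x. u0 x (\<theta> t x)) \<longlongrightarrow> 0) at_infinity" "((\<lambda>x. u1 x (\<theta> t x)) \<longlongrightarrow> 0) at_top"
  shows "u0 x (\<theta> t x) = 0"
proof (rule ccontr)
  define U where "U = (\<lambda>x. u0 x (\<theta> t x))"
  define U1 where "U1 = (\<lambda>x. u1 x (\<theta> t x))"
  define E where "E = (\<lambda>x. (U1 x)\<^sup>2 + 4 / (1 + real q) * U x ^ Suc q)"
  have dU: "(U has_real_derivative U1 x) (at x)" and dU1: "(U1 has_real_derivative - 2 * U x ^ q) (at x)" for x
    unfolding U_def U1_def by (rule deriv_u0, rule eq)
  have "(E has_real_derivative 0) (at x)" for x
    unfolding E_def
    by (rule DERIV_cong[OF DERIV_add[OF DERIV_power[OF dU1, of 2] DERIV_cmult[OF DERIV_power_Suc[OF dU]]]])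
       (simp add: add_nonneg_eq_0_iff)
  hence "\<exists>c. \<forall>x. E x = c" using DERIV_isconst_all[of E] by blast
  then obtain c where c: "\<And>x. E x = c" by blast
  have "(E \<longlongrightarrow> 0\<^sup>2 + 4 / (1 + real q) * 0 ^ Suc q) at_top"
    unfolding E_def U_def U1_def
    by (intro tendsto_intros tendsto_mono[OF at_top_le_at_infinity lim(1)] lim(2))
  moreover have "E = (\<lambda>_. c)" using c by auto
  ultimately have "c = 0" by (simp add: tendsto_const_iff)
  assume "u0 x (\<theta> t x) \<noteq> 0"
  then obtain z where z: "U z \<noteq> 0" "U1 z = 0"
    using vanishing_at_infinity_attains_max_abs[OF dU lim(1)[folded U_def], of x] unfolding U_def by blast
  from c[of z] \<open>c = 0\<close> z show False by (simp add: E_def)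
qed

end

section \<open>Breathers up to scaling and translation\<close>

lemma quasimonochromatic_breather_explicit:
  assumes br: "quasimonochromatic_breather_with q m \<alpha> F p u" and q: "q \<ge> 2"
    and nz: "u \<noteq> (\<lambda>t x. 0)"
  obtains \<epsilon> x2 where "q = 3" "\<epsilon> = 1 \<or> \<epsilon> = -1"
    "\<And>t x. u t x = 2 * deriv (\<lambda>x. arctan (\<epsilon> * sqrt 3 *
        (sin (2 * \<alpha> * x - 64 * \<alpha> ^ 3 * t) / cosh (2 * sqrt 3 * \<alpha> * x + x2)))) x"
proof -
  define a where "a = 2 * \<alpha>"
  have sol: "gKdV_smooth_solution q u"
    and u: "\<And>t x. u t x = deriv (\<lambda>y. F (p y * sin (a * (y + m * t)))) x"
    and a: "a > 0" and smooth: "smooth F" and C_2: "C_k 2 p" and p_nonzero: "p \<noteq> (\<lambda>_. 0)"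
    and lim: "(p \<longlongrightarrow> 0) at_infinity" "(deriv p \<longlongrightarrow> 0) at_infinity" "((deriv ^^ 2) p \<longlongrightarrow> 0) at_infinity"
    using br unfolding quasimonochromatic_breather_with_def a_def by auto
  interpret ansatz m a F "(deriv ^^ 1) F" "(deriv ^^ 2) F" "(deriv ^^ 3) F" "(deriv ^^ 4) F" p "deriv p" "(deriv ^^ 2) p"
  proof
    fix x
    show "(F has_real_derivative (deriv ^^ 1) F x) (at x)"
      "((deriv ^^ 1) F has_real_derivative (deriv ^^ 2) F x) (at x)"
      "((deriv ^^ 2) F has_real_derivative (deriv ^^ 3) F x) (at x)"
      "((deriv ^^ 3) F has_real_derivative (deriv ^^ 4) F x) (at x)"
      using smooth_has_derivative[OF smooth, of 0 x] smooth_has_derivative[OF smooth, of 1 x]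
        smooth_has_derivative[OF smooth, of 2 x] smooth_has_derivative[OF smooth, of 3 x]
      by (simp_all add: eval_nat_numeral)
    show "(p has_real_derivative deriv p x) (at x)"
      "(deriv p has_real_derivative (deriv ^^ 2) p x) (at x)"
      using C_2_has_derivatives[OF C_2] by auto
    show "isCont ((deriv ^^ 2) p) x"
      using C_2_has_derivatives(3)[OF C_2] by (simp add: continuous_on_eq_continuous_at)
  qed
  have uu: "u t x = u0 x (\<theta> t x)" for t x
    unfolding u by (rule DERIV_imp_deriv) (rule deriv_v[unfolded y_def])
  hence "u = (\<lambda>t x. u0 x (\<theta> t x))" by (intro ext)
  note sol' = sol[unfolded this]
  note ltop = lim[THEN tendsto_mono[OF at_top_le_at_infinity]]
  have eq: "((\<lambda>x. u1 x (\<theta> t x)) has_real_derivative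
         - (deriv ^^ 1) F (y x (\<theta> t x)) * yt x (\<theta> t x) - 2 * u0 x (\<theta> t x) ^ q) (at x)" for t x
    by (rule integrated_equation[OF sol' _ ltop]) (use q in simp)
  obtain t0 x0 where nz0: "u0 x0 (\<theta> t0 x0) \<noteq> 0" using nz uu by (metis ext)
  have m: "m \<noteq> 0"
  proof
    assume m0: "m = 0"
    have yt0: "yt x \<phi> = 0" for x \<phi> unfolding yt_def using m0 by simp
    have "u0 x0 (\<theta> t0 x0) = 0"
    proof (rule stationary_trivial[where q = q])
      show "((\<lambda>x. u1 x (\<theta> t0 x)) has_real_derivative - 2 * u0 x (\<theta> t0 x) ^ q) (at x)" for x
        using eq[of t0 x] by (simp add: yt0)
      show "((\<lambda>x. u1 x (\<theta> t0 x)) \<longlongrightarrow> 0) at_top" by (rule tendsto_wave_zero(2)[OF ltop])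
    qed (use q tendsto_wave_zero(1)[OF lim] in auto)
    with nz0 show False ..
  qed
  interpret breather m a F "(deriv ^^ 1) F" "(deriv ^^ 2) F" "(deriv ^^ 3) F" "(deriv ^^ 4) F" p "deriv p" "(deriv ^^ 2) p" q
  proof
    show "\<exists>x. p x \<noteq> 0" using p_nonzero by auto
  qed (use a m q lim eq nz0 in blast)+
  obtain \<epsilon> x2 where \<epsilon>: "\<epsilon> = 1 \<or> \<epsilon> = -1"
    and ex: "\<And>t x. ((\<lambda>x. 2 * arctan (\<epsilon> * sqrt 3 * (sin (a * x - 8 * a ^ 3 * t) / cosh (sqrt 3 * a * x + x2))))
       has_real_derivative u0 x (\<theta> t x)) (at x)"
    using explicit_form by blast
  show thesis
  proof (rule that)
    show "q = 3" by (rule power_is_3)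
    show "\<epsilon> = 1 \<or> \<epsilon> = -1" by fact
    fix t x
    have "((\<lambda>x. arctan (\<epsilon> * sqrt 3 * (sin (a * x - 8 * a ^ 3 * t) / cosh (sqrt 3 * a * x + x2))))
       has_real_derivative u0 x (\<theta> t x) / 2) (at x)"
      using DERIV_cdivide[OF ex[of t x], of 2] by simp
    from DERIV_imp_deriv[OF this] show "u t x = 2 * deriv (\<lambda>x. arctan (\<epsilon> * sqrt 3 *
        (sin (2 * \<alpha> * x - 64 * \<alpha> ^ 3 * t) / cosh (2 * sqrt 3 * \<alpha> * x + x2)))) x"
      by (simp add: uu a_def power_mult_distrib mult_ac)
  qed
qed

text \<open>The scaling and the translations act on the parameters: \<open>\<alpha>\<close> becomes \<open>l \<alpha>\<close> and the two phases are
shifted.\<close>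

lemma B_scaling:
  "l * B \<alpha> x1 x2 (l ^ 3 * (t + t0)) (l * (x + x0)) =
   - 2 * deriv (\<lambda>x. arctan (sqrt 3 * (sin (2 * (l * \<alpha>) * x - 64 * (l * \<alpha>) ^ 3 * t
        + (2 * (l * \<alpha>) * x0 - 64 * (l * \<alpha>) ^ 3 * t0 + x1))
      / cosh (2 * sqrt 3 * (l * \<alpha>) * x + (2 * sqrt 3 * (l * \<alpha>) * x0 + x2))))) x"
proof -
  define g where "g = (\<lambda>y. arctan (sqrt 3 *
       (sin (2 * \<alpha> * y - 64 * \<alpha> ^ 3 * (l ^ 3 * (t + t0)) + x1) / cosh (2 * sqrt 3 * \<alpha> * y + x2))))"
  have dg: "(g has_real_derivative deriv g z) (at z)" for z
  proof -
    have "g differentiable (at z)"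
      unfolding g_def by (rule differentiableI) (auto intro!: derivative_eq_intros)
    thus ?thesis by (simp add: DERIV_deriv_iff_real_differentiable)
  qed
  have "((\<lambda>x. g (l * (x + x0))) has_real_derivative deriv g (l * (x + x0)) * l) (at x)"
    by (rule DERIV_chain2[OF dg]) (auto intro!: derivative_eq_intros)
  hence "deriv (\<lambda>x. g (l * (x + x0))) x = deriv g (l * (x + x0)) * l" by (rule DERIV_imp_deriv)
  moreover have "(\<lambda>x. g (l * (x + x0))) = (\<lambda>x. arctan (sqrt 3 * (sin (2 * (l * \<alpha>) * x - 64 * (l * \<alpha>) ^ 3 * t
        + (2 * (l * \<alpha>) * x0 - 64 * (l * \<alpha>) ^ 3 * t0 + x1))
      / cosh (2 * sqrt 3 * (l * \<alpha>) * x + (2 * sqrt 3 * (l * \<alpha>) * x0 + x2)))))"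
    unfolding g_def by (simp add: algebra_simps)
  ultimately show ?thesis unfolding B_def g_def[symmetric] by simp
qed

text \<open>The scale \<open>l\<close> matches the frequencies, \<open>x0\<close> the centres and then \<open>t0\<close> the phases.  The sign
\<open>\<epsilon>\<close> is absorbed by a further half period of the sine.\<close>

lemma breather_is_scaled_shifted_B:
  assumes \<alpha>: "\<alpha> > 0" and \<alpha>': "\<alpha>' > 0" and \<epsilon>: "\<epsilon> = 1 \<or> \<epsilon> = -1"
    and u: "\<And>t x. u t x = 2 * deriv (\<lambda>x. arctan (\<epsilon> * sqrt 3 *
        (sin (2 * \<alpha>' * x - 64 * \<alpha>' ^ 3 * t) / cosh (2 * sqrt 3 * \<alpha>' * x + x2')))) x"
  shows "\<exists>l>0. \<exists>t0 x0. u = (\<lambda>t x. l * B \<alpha> x1 x2 (l ^ 3 * (t + t0)) (l * (x + x0)))"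
proof -
  define l where "l = \<alpha>' / \<alpha>"
  have l: "l > 0" "l * \<alpha> = \<alpha>'" using \<alpha> \<alpha>' by (simp_all add: l_def)
  define x0 where "x0 = (x2' - x2) / (2 * sqrt 3 * \<alpha>')"
  have x0: "2 * sqrt 3 * \<alpha>' * x0 + x2 = x2'" using \<alpha>' by (simp add: x0_def)
  \<comment> \<open>The factor \<open>-2\<close> in \<open>B\<close> against the factor \<open>2\<close> here: the half period is needed for \<open>\<epsilon> = 1\<close>.\<close>
  define \<psi> where "\<psi> = (if \<epsilon> = 1 then pi else 0)"
  define t0 where "t0 = (2 * \<alpha>' * x0 + x1 - \<psi>) / (64 * \<alpha>' ^ 3)"
  have t0: "2 * \<alpha>' * x0 - 64 * \<alpha>' ^ 3 * t0 + x1 = \<psi>" using \<alpha>' by (simp add: t0_def)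
  have sin: "sin (\<phi> + \<psi>) = - \<epsilon> * sin \<phi>" for \<phi> using \<epsilon> by (auto simp: \<psi>_def)
  have "u t x = l * B \<alpha> x1 x2 (l ^ 3 * (t + t0)) (l * (x + x0))" for t x
  proof -
    define g where "g = (\<lambda>x. arctan (\<epsilon> * sqrt 3 * (sin (2 * \<alpha>' * x - 64 * \<alpha>' ^ 3 * t) / cosh (2 * sqrt 3 * \<alpha>' * x + x2'))))"
    have "g differentiable (at x)"
      unfolding g_def by (rule differentiableI) (auto intro!: derivative_eq_intros)
    hence "((\<lambda>x. - g x) has_real_derivative - deriv g x) (at x)"
      by (intro DERIV_minus) (simp add: DERIV_deriv_iff_real_differentiable)
    moreover have "(\<lambda>x. - g x) = (\<lambda>x. arctan (sqrt 3 * (- \<epsilon> * sin (2 * \<alpha>' * x - 64 * \<alpha>' ^ 3 * t)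
        / cosh (2 * sqrt 3 * \<alpha>' * x + x2'))))"
      unfolding g_def by (simp add: mult_ac flip: arctan_minus)
    ultimately have "deriv (\<lambda>x. arctan (sqrt 3 * (- \<epsilon> * sin (2 * \<alpha>' * x - 64 * \<alpha>' ^ 3 * t)
        / cosh (2 * sqrt 3 * \<alpha>' * x + x2')))) x = - deriv g x"
      using DERIV_imp_deriv by fastforce
    thus ?thesis unfolding B_scaling l(2) x0 t0 sin u g_def[symmetric] by simp
  qed
  hence "u = (\<lambda>t x. l * B \<alpha> x1 x2 (l ^ 3 * (t + t0)) (l * (x + x0)))" by (intro ext)
  with l(1) show ?thesis by blast
qed

section \<open>The explicit breather as a smooth function\<close>

text \<open>A class of functions of \<open>(t, x)\<close> that contains \<open>B\<close> and is closed under both partial derivatives;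
such functions are smooth in the plane.\<close>

inductive elementary :: "(real \<Rightarrow> real \<Rightarrow> real) \<Rightarrow> bool" where
  const: "elementary (\<lambda>t x. c)"
| sin: "elementary (\<lambda>t x. sin (k * x + l * t + c))"
| cos: "elementary (\<lambda>t x. cos (k * x + l * t + c))"
| exp: "elementary (\<lambda>t x. exp (k * x + l * t + c))"
| add: "elementary f \<Longrightarrow> elementary g \<Longrightarrow> elementary (\<lambda>t x. f t x + g t x)"
| mult: "elementary f \<Longrightarrow> elementary g \<Longrightarrow> elementary (\<lambda>t x. f t x * g t x)"
| inverse: "elementary f \<Longrightarrow> (\<And>t x. f t x \<noteq> 0) \<Longrightarrow> elementary (\<lambda>t x. inverse (f t x))"

lemma elementary_continuous: "elementary f \<Longrightarrow> continuous_on UNIV (\<lambda>(t, x). f t x)"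
  by (induction rule: elementary.induct) (auto simp: split_def intro!: continuous_intros)

lemma elementary_partials:
  "elementary f \<Longrightarrow> \<exists>ft fx. (\<forall>t x. ((\<lambda>s. f s x) has_real_derivative ft t x) (at t)) \<and>
     (\<forall>t x. (f t has_real_derivative fx t x) (at x)) \<and> elementary ft \<and> elementary fx"
proof (induction rule: elementary.induct)
  case (const c)
  show ?case
    by (rule exI[of _ "\<lambda>t x. 0"], rule exI[of _ "\<lambda>t x. 0"]) (auto intro: elementary.const)
next
  case (sin k l c)
  show ?case
    by (rule exI[of _ "\<lambda>t x. l * cos (k * x + l * t + c)"], rule exI[of _ "\<lambda>t x. k * cos (k * x + l * t + c)"])
       (auto intro!: elementary.intros derivative_eq_intros)
next
  case (cos k l c)
  show ?case
    by (rule exI[of _ "\<lambda>t x. (- l) * sin (k * x + l * t + c)"],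
        rule exI[of _ "\<lambda>t x. (- k) * sin (k * x + l * t + c)"])
       (intro conjI allI elementary.intros; auto intro!: derivative_eq_intros)
next
  case (exp k l c)
  show ?case
    by (rule exI[of _ "\<lambda>t x. l * exp (k * x + l * t + c)"], rule exI[of _ "\<lambda>t x. k * exp (k * x + l * t + c)"])
       (auto intro!: elementary.intros derivative_eq_intros)
next
  case (add f g)
  then obtain ft fx gt gx where
    "\<And>t x. ((\<lambda>s. f s x) has_real_derivative ft t x) (at t)" "\<And>t x. (f t has_real_derivative fx t x) (at x)"
    "\<And>t x. ((\<lambda>s. g s x) has_real_derivative gt t x) (at t)" "\<And>t x. (g t has_real_derivative gx t x) (at x)"
    "elementary ft" "elementary fx" "elementary gt" "elementary gx" by blast
  thus ?case
    by (intro exI[of _ "\<lambda>t x. ft t x + gt t x"] exI[of _ "\<lambda>t x. fx t x + gx t x"] conjI allI DERIV_add elementary.add)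
next
  case (mult f g)
  then obtain ft fx gt gx where
    d: "\<And>t x. ((\<lambda>s. f s x) has_real_derivative ft t x) (at t)" "\<And>t x. (f t has_real_derivative fx t x) (at x)"
    "\<And>t x. ((\<lambda>s. g s x) has_real_derivative gt t x) (at t)" "\<And>t x. (g t has_real_derivative gx t x) (at x)"
    and e: "elementary ft" "elementary fx" "elementary gt" "elementary gx" by blast
  show ?case
    by (intro exI[of _ "\<lambda>t x. ft t x * g t x + gt t x * f t x"] exI[of _ "\<lambda>t x. fx t x * g t x + gx t x * f t x"]
        conjI allI DERIV_mult elementary.add elementary.mult d e mult.hyps)
next
  case (inverse f)
  then obtain ft fx where
    d: "\<And>t x. ((\<lambda>s. f s x) has_real_derivative ft t x) (at t)" "\<And>t x. (f t has_real_derivative fx t x) (at x)"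
    and e: "elementary ft" "elementary fx" by blast
  show ?case
    by (rule exI[of _ "\<lambda>t x. (- 1) * (inverse (f t x) * ft t x * inverse (f t x))"],
        rule exI[of _ "\<lambda>t x. (- 1) * (inverse (f t x) * fx t x * inverse (f t x))"])
       (intro conjI allI elementary.const elementary.mult elementary.inverse inverse.hyps e
         DERIV_cong[OF DERIV_inverse'[OF d(1)]] DERIV_cong[OF DERIV_inverse'[OF d(2)]]; simp)
qed

lemma elementary_smooth_plane:
  assumes "elementary f"
  shows "smooth_plane f"
proof -
  have "elementary f \<Longrightarrow> C_k_plane k f" for k f
  proof (induction k arbitrary: f)
    case 0
    thus ?case by (simp add: elementary_continuous)
  next
    case (Suc k)
    from elementary_partials[OF Suc.prems] Suc.IH show ?case unfolding C_k_plane.simps by blast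
  qed
  with assms show ?thesis by (simp add: smooth_plane_def)
qed

lemma B_explicit:
  "B \<alpha> x1 x2 t x = - 2 * (sqrt 3 * ((2 * \<alpha>) * cos (2 * \<alpha> * x - 64 * \<alpha> ^ 3 * t + x1) * cosh (2 * sqrt 3 * \<alpha> * x + x2)
      - (2 * sqrt 3 * \<alpha>) * sin (2 * \<alpha> * x - 64 * \<alpha> ^ 3 * t + x1) * sinh (2 * sqrt 3 * \<alpha> * x + x2)))
    * inverse ((cosh (2 * sqrt 3 * \<alpha> * x + x2))\<^sup>2 + 3 * (sin (2 * \<alpha> * x - 64 * \<alpha> ^ 3 * t + x1))\<^sup>2)"
proof -
  define C where "C = cosh (2 * sqrt 3 * \<alpha> * x + x2)"
  define s where "s = sin (2 * \<alpha> * x - 64 * \<alpha> ^ 3 * t + x1)"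
  define N where "N = (2 * \<alpha>) * cos (2 * \<alpha> * x - 64 * \<alpha> ^ 3 * t + x1) * cosh (2 * sqrt 3 * \<alpha> * x + x2)
      - (2 * sqrt 3 * \<alpha>) * sin (2 * \<alpha> * x - 64 * \<alpha> ^ 3 * t + x1) * sinh (2 * sqrt 3 * \<alpha> * x + x2)"
  have C: "C > 0" by (simp add: C_def)
  have "((\<lambda>y. sin (2 * \<alpha> * y - 64 * \<alpha> ^ 3 * t + x1) / cosh (2 * sqrt 3 * \<alpha> * y + x2)) has_real_derivative N / C\<^sup>2) (at x)"
    unfolding N_def C_def by (auto intro!: derivative_eq_intros simp: power2_eq_square)
  from DERIV_chain2[OF DERIV_arctan DERIV_cmult[OF this]]
  have "((\<lambda>y. arctan (sqrt 3 * (sin (2 * \<alpha> * y - 64 * \<alpha> ^ 3 * t + x1) / cosh (2 * sqrt 3 * \<alpha> * y + x2))))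
      has_real_derivative inverse (1 + (sqrt 3 * (s / C))\<^sup>2) * (sqrt 3 * (N / C\<^sup>2))) (at x)"
    unfolding s_def C_def .
  moreover have "inverse (1 + (sqrt 3 * (s / C))\<^sup>2) * (sqrt 3 * (N / C\<^sup>2)) = sqrt 3 * N * inverse (C\<^sup>2 + 3 * s\<^sup>2)"
  proof -
    have "1 + (sqrt 3 * (s / C))\<^sup>2 = (C\<^sup>2 + 3 * s\<^sup>2) / C\<^sup>2"
      using C by (simp add: power_mult_distrib power_divide field_simps)
    thus ?thesis using C by (simp add: inverse_eq_divide)
  qed
  ultimately have "deriv (\<lambda>y. arctan (sqrt 3 * (sin (2 * \<alpha> * y - 64 * \<alpha> ^ 3 * t + x1) / cosh (2 * sqrt 3 * \<alpha> * y + x2)))) x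
      = sqrt 3 * N * inverse (C\<^sup>2 + 3 * s\<^sup>2)" by (simp add: DERIV_imp_deriv)
  thus ?thesis unfolding B_def N_def C_def s_def by simp
qed

lemma B_nonzero:
  assumes "\<alpha> > 0" shows "B \<alpha> x1 x2 \<noteq> (\<lambda>t x. 0)"
proof
  assume "B \<alpha> x1 x2 = (\<lambda>t x. 0)"
  \<comment> \<open>At this time the sine vanishes at the origin, and the cosine is \<open>1\<close>.\<close>
  moreover have "2 * \<alpha> * 0 - 64 * \<alpha> ^ 3 * (x1 / (64 * \<alpha> ^ 3)) + x1 = 0" using assms by simp
  ultimately show False using B_explicit[of \<alpha> x1 x2 "x1 / (64 * \<alpha> ^ 3)" 0] assms by simp
qed

lemma B_smooth_plane: "smooth_plane (B \<alpha> x1 x2)"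
proof (rule elementary_smooth_plane)
  define s where "s = (\<lambda>t x. sin (2 * \<alpha> * x + (- (64 * \<alpha> ^ 3)) * t + x1))"
  define c where "c = (\<lambda>t x. cos (2 * \<alpha> * x + (- (64 * \<alpha> ^ 3)) * t + x1))"
  define e where "e = (\<lambda>(t::real) x. exp (2 * sqrt 3 * \<alpha> * x + 0 * t + x2))"
  define e' where "e' = (\<lambda>(t::real) x. exp ((- (2 * sqrt 3 * \<alpha>)) * x + 0 * t + (- x2)))"
  have el: "elementary s" "elementary c" "elementary e" "elementary e'"
    unfolding s_def c_def e_def e'_def by (intro elementary.intros)+
  define C where "C = (\<lambda>t x. 1 / 2 * (e t x + e' t x))"
  define S where "S = (\<lambda>t x. 1 / 2 * (e t x + (- 1) * e' t x))"
  have CS: "C t x = cosh (2 * sqrt 3 * \<alpha> * x + x2)" "S t x = sinh (2 * sqrt 3 * \<alpha> * x + x2)" for t x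
    unfolding C_def S_def e_def e'_def by (simp_all add: cosh_field_def sinh_field_def)
  have elCS: "elementary C" "elementary S"
    unfolding C_def S_def by (intro elementary.intros el)+
  have "C t x * C t x + 3 * (s t x * s t x) \<noteq> 0" for t x
  proof -
    have "C t x * C t x > 0" unfolding CS by simp
    moreover have "3 * (s t x * s t x) \<ge> 0" by simp
    ultimately show ?thesis by linarith
  qed
  hence "elementary (\<lambda>t x. (- 2) * (sqrt 3 * ((2 * \<alpha>) * c t x * C t x + (- (2 * sqrt 3 * \<alpha>)) * s t x * S t x))
     * inverse (C t x * C t x + 3 * (s t x * s t x)))"
    by (intro elementary.intros el elCS)
  moreover have "(\<lambda>t x. (- 2) * (sqrt 3 * ((2 * \<alpha>) * c t x * C t x + (- (2 * sqrt 3 * \<alpha>)) * s t x * S t x))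
     * inverse (C t x * C t x + 3 * (s t x * s t x))) = B \<alpha> x1 x2"
    unfolding CS s_def c_def by (intro ext) (simp add: B_explicit power2_eq_square)
  ultimately show "elementary (B \<alpha> x1 x2)" by simp
qed

section \<open>The arctangent profile\<close>

text \<open>This avoids explicit formulas for the higher derivatives: a class of functions in which their shape
is visible is enough.\<close>

lemma smooth_if_closed_under_deriv:
  assumes closed: "\<And>f. f \<in> S \<Longrightarrow> \<exists>g\<in>S. \<forall>x. (f has_real_derivative g x) (at x)" and f: "f \<in> S"
  shows "smooth f"
proof -
  have step: "deriv g \<in> S" "(g has_real_derivative deriv g x) (at x)" if g: "g \<in> S" for g x
  proof -
    obtain h where h: "h \<in> S" "\<And>x. (g has_real_derivative h x) (at x)" using closed[OF g] by blast
    have "deriv g = h" by (rule ext) (rule DERIV_imp_deriv[OF h(2)])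
    with h show "deriv g \<in> S" "(g has_real_derivative deriv g x) (at x)" by auto
  qed
  have inS: "(deriv ^^ j) f \<in> S" for j by (induction j) (use f step in auto)
  hence d: "((deriv ^^ j) f has_real_derivative deriv ((deriv ^^ j) f) x) (at x)" for j x by (rule step)
  show ?thesis
    unfolding smooth_def C_k_def real_differentiable_def
    using d by (blast intro: continuous_at_imp_continuous_on DERIV_isCont)
qed

lemma arctan_derivatives:
  fixes x :: real
  shows "((\<lambda>y. 2 * arctan (y / 2)) has_real_derivative 4 / (4 + x\<^sup>2)) (at x)"
    and "((\<lambda>y. 4 / (4 + y\<^sup>2)) has_real_derivative - (8 * x) / (4 + x\<^sup>2)\<^sup>2) (at x)"
    and "((\<lambda>y. - (8 * y) / (4 + y\<^sup>2)\<^sup>2) has_real_derivative - 8 / (4 + x\<^sup>2)\<^sup>2 + 32 * x\<^sup>2 / (4 + x\<^sup>2) ^ 3) (at x)"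
    and "((\<lambda>y. - 8 / (4 + y\<^sup>2)\<^sup>2 + 32 * y\<^sup>2 / (4 + y\<^sup>2) ^ 3) has_real_derivative
        96 * x / (4 + x\<^sup>2) ^ 3 - 192 * x ^ 3 / (4 + x\<^sup>2) ^ 4) (at x)"
proof -
  define Q where "Q = (\<lambda>y::real. 4 + y\<^sup>2)"
  have Q: "Q y \<noteq> 0" for y using zero_le_power2[of y] unfolding Q_def by linarith
  have Qe: "4 + y\<^sup>2 = Q y" for y by (simp add: Q_def)
  have dQ: "(Q has_real_derivative 2 * x) (at x)" unfolding Q_def by (auto intro!: derivative_eq_intros)
  have "((\<lambda>y. 2 * arctan (y / 2)) has_real_derivative 2 * (inverse (1 + (x / 2)\<^sup>2) * (1 / 2))) (at x)"
    by (intro DERIV_cmult DERIV_chain2[OF DERIV_arctan] DERIV_cdivide DERIV_ident)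
  also have "1 + (x / 2)\<^sup>2 = Q x / 4" by (simp add: power_divide Q_def)
  also have "2 * (inverse (Q x / 4) * (1 / 2)) = 4 / Q x" by (simp add: inverse_eq_divide)
  finally show "((\<lambda>y. 2 * arctan (y / 2)) has_real_derivative 4 / (4 + x\<^sup>2)) (at x)"
    by (simp only: Q_def)
  show "((\<lambda>y. 4 / (4 + y\<^sup>2)) has_real_derivative - (8 * x) / (4 + x\<^sup>2)\<^sup>2) (at x)"
    unfolding Qe using Q[of x]
    by (auto intro!: derivative_eq_intros dQ simp: field_simps power2_eq_square)
  show "((\<lambda>y. - (8 * y) / (4 + y\<^sup>2)\<^sup>2) has_real_derivative - 8 / (4 + x\<^sup>2)\<^sup>2 + 32 * x\<^sup>2 / (4 + x\<^sup>2) ^ 3) (at x)"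
    unfolding Qe using Q[of x]
    by (auto intro!: derivative_eq_intros dQ simp: field_simps power2_eq_square power3_eq_cube)
  show "((\<lambda>y. - 8 / (4 + y\<^sup>2)\<^sup>2 + 32 * y\<^sup>2 / (4 + y\<^sup>2) ^ 3) has_real_derivative
        96 * x / (4 + x\<^sup>2) ^ 3 - 192 * x ^ 3 / (4 + x\<^sup>2) ^ 4) (at x)"
    unfolding Qe using Q[of x]
    by (auto intro!: derivative_eq_intros dQ simp: field_simps power2_eq_square power3_eq_cube power4_eq_xxxx)
qed

lemma smooth_arctan: "smooth (\<lambda>y. 2 * arctan (y / 2))"
proof (rule smooth_if_closed_under_deriv)
  define R where "R = (\<lambda>P n (y::real). poly P y * inverse (4 + y\<^sup>2) ^ n)"
  define S where "S = insert (\<lambda>y. 2 * arctan (y / 2)) {R P n |P n. True}"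
  have pos: "4 + y\<^sup>2 \<noteq> 0" for y :: real using zero_le_power2[of y] by linarith
  show "(\<lambda>y. 2 * arctan (y / 2)) \<in> S" by (simp add: S_def)
  fix f assume "f \<in> S"
  then consider "f = (\<lambda>y. 2 * arctan (y / 2))" | P n where "f = R P n" by (auto simp: S_def)
  thus "\<exists>g\<in>S. \<forall>x. (f has_real_derivative g x) (at x)"
  proof cases
    case 1
    have "(f has_real_derivative R [:4:] 1 x) (at x)" for x
      unfolding 1 by (rule DERIV_cong[OF arctan_derivatives(1)]) (simp add: R_def inverse_eq_divide)
    moreover have "R [:4:] 1 \<in> S" by (auto simp: S_def)
    ultimately show ?thesis by blast
  next
    case 2
    have "(f has_real_derivative R (pderiv P * [:4, 0, 1:] - smult (of_nat n) (P * [:0, 2:])) (Suc n) x) (at x)" for x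
    proof -
      have i: "((\<lambda>y. inverse (4 + y\<^sup>2)) has_real_derivative - (2 * x * inverse (4 + x\<^sup>2) ^ 2)) (at x)"
        using pos[of x] by (auto intro!: derivative_eq_intros simp: power2_eq_square)
      have n: "((\<lambda>y. inverse (4 + y\<^sup>2) ^ n) has_real_derivative - (n * (2 * x) * inverse (4 + x\<^sup>2) ^ Suc n)) (at x)"
      proof (cases n)
        case (Suc k)
        show ?thesis unfolding Suc
          by (rule DERIV_cong[OF DERIV_power_Suc[OF i]]) (simp add: power2_eq_square)
      qed simp
      have D: "(f has_real_derivative poly (pderiv P) x * inverse (4 + x\<^sup>2) ^ n
          + - (n * (2 * x) * inverse (4 + x\<^sup>2) ^ Suc n) * poly P x) (at x)"
        unfolding 2 R_def by (rule DERIV_mult[OF poly_DERIV n])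
      have e: "inverse (4 + x\<^sup>2) ^ n = (4 + x\<^sup>2) * inverse (4 + x\<^sup>2) ^ Suc n" using pos[of x] by simp
      show ?thesis
        by (rule DERIV_cong[OF D], unfold e R_def)
           (simp add: algebra_simps power2_eq_square del: power_Suc)
    qed
    moreover have "R (pderiv P * [:4, 0, 1:] - smult (of_nat n) (P * [:0, 2:])) (Suc n) \<in> S" by (auto simp: S_def)
    ultimately show ?thesis by blast
  qed
qed

text \<open>The formally integrated series converges by comparison, and its sum has the same derivative as
\<open>f\<close> and the same value at \<open>0\<close>.\<close>

lemma has_fps_expansion_antiderivative:
  fixes f f' :: "real \<Rightarrow> real"
  assumes d: "\<And>x. (f has_real_derivative f' x) (at x)" and G: "f' has_fps_expansion G"
  shows "f has_fps_expansion fps_integral G (f 0)"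
proof -
  define I where "I = fps_integral G (f 0)"
  have dI: "fps_deriv I = G" unfolding I_def by (rule fps_deriv_fps_integral)
  have rad: "fps_conv_radius G \<le> fps_conv_radius I"
    unfolding fps_conv_radius_def
  proof (rule conv_radius_geI_ex')
    fix r :: real assume r: "0 < r" "ereal r < conv_radius (fps_nth G)"
    have "summable (\<lambda>n. norm (fps_nth G n * r ^ n))"
      using r by (intro abs_summable_in_conv_radius) auto
    hence "summable (\<lambda>n. r * norm (fps_nth G n * r ^ n))" by (rule summable_mult)
    hence "summable (\<lambda>n. fps_nth I (Suc n) * r ^ Suc n)"
    proof (rule summable_comparison_test'[where N = 0])
      fix n :: nat
      have "norm (fps_nth I (Suc n) * r ^ Suc n) = inverse (real (Suc n)) * (r * norm (fps_nth G n * r ^ n))"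
        using r by (simp add: I_def norm_mult abs_mult)
      also have "\<dots> \<le> 1 * (r * norm (fps_nth G n * r ^ n))"
        using r by (intro mult_right_mono) (auto simp: field_simps)
      finally show "norm (fps_nth I (Suc n) * r ^ Suc n) \<le> r * norm (fps_nth G n * r ^ n)" by simp
    qed
    thus "summable (\<lambda>n. fps_nth I n * of_real r ^ n)" using summable_Suc_iff[of "\<lambda>n. fps_nth I n * r ^ n"] by simp
  qed
  have pos: "fps_conv_radius G > 0" and ev: "\<forall>\<^sub>F z in nhds 0. eval_fps G z = f' z"
    using G unfolding has_fps_expansion_def by auto
  from ev obtain e where e: "e > 0" "\<And>z. dist z 0 < e \<Longrightarrow> eval_fps G z = f' z"
    unfolding eventually_nhds_metric by blast
  obtain r :: real where r: "0 < r" "r \<le> e" "ereal r \<le> fps_conv_radius G"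
  proof -
    from ereal_dense2[OF pos] obtain K :: real where K: "0 < ereal K" "ereal K < fps_conv_radius G" by auto
    have "ereal (min K e) \<le> fps_conv_radius G" by (rule order.trans[OF _ less_imp_le[OF K(2)]]) simp
    thus ?thesis using e(1) K(1) by (intro that[of "min K e"]) auto
  qed
  have eq: "eval_fps I z = f z" if z: "z \<in> {- r<..<r}" for z
  proof -
    have "((\<lambda>z. eval_fps I z - f z) has_real_derivative 0) (at w)" if w: "w \<in> {- r<..<r}" for w
    proof -
      have aw: "\<bar>w\<bar> < r" using w by auto
      hence "ereal (norm w) < fps_conv_radius I" using r(3) rad
        by (simp add: less_le_trans[of _ "ereal r"] order.trans)
      from has_field_derivative_eval_fps[OF this] have "(eval_fps I has_real_derivative f' w) (at w)"
        unfolding dI using e(2)[of w] aw r(2) by simp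
      from DERIV_diff[OF this d[of w]] show ?thesis by simp
    qed
    hence "eval_fps I z - f z = eval_fps I 0 - f 0"
      by (intro DERIV_isconst3[of "- r" r z 0 "\<lambda>z. eval_fps I z - f z"]) (use z r in auto)
    thus ?thesis by (simp add: eval_fps_at_0 I_def)
  qed
  have "\<forall>\<^sub>F z in nhds 0. z \<in> {- r<..<r}" by (rule eventually_nhds_in_open) (use r in auto)
  hence "\<forall>\<^sub>F z in nhds 0. eval_fps I z = f z" by eventually_elim (rule eq)
  thus ?thesis unfolding has_fps_expansion_def I_def[symmetric] using pos rad by auto
qed

lemma arctan_real_analytic: "real_analytic_on (\<lambda>y. 2 * arctan (y / 2)) UNIV"
  unfolding real_analytic_on_def
proof (intro ballI)
  fix x :: real
  have fps: "(\<lambda>h. 4 * inverse (4 + (x + h) * (x + h))) has_fps_expansion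
      fps_const 4 * inverse (4 + (fps_const x + fps_X) * (fps_const x + fps_X))"
  proof (intro fps_expansion_intros)
    have "4 + x * x > 0" by (intro add_pos_nonneg) auto
    thus "fps_nth (4 + (fps_const x + fps_X) * (fps_const x + fps_X)) 0 \<noteq> 0" by simp
  qed
  have "((\<lambda>h. 2 * arctan ((x + h) / 2)) has_real_derivative 4 * inverse (4 + (x + h) * (x + h))) (at h)" for h
  proof -
    have "((\<lambda>h. x + h) has_real_derivative 1) (at h)" by (auto intro!: derivative_eq_intros)
    from DERIV_chain2[OF arctan_derivatives(1) this] show ?thesis
      by (rule DERIV_cong) (simp add: power2_eq_square inverse_eq_divide)
  qed
  from has_fps_expansion_antiderivative[OF this fps]
  show "\<exists>G. (\<lambda>h. 2 * arctan ((x + h) / 2)) has_fps_expansion G" by (rule exI)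
qed

context ansatz begin

section \<open>The explicit breather as a solution\<close>

lemma solution_if_residual_zero:
  assumes sm: "smooth_plane (\<lambda>t x. u0 x (\<theta> t x))"
    and p2': "\<And>x. (p2 has_real_derivative p3 x) (at x)"
    and res: "\<And>x \<phi>. residual q (p3 x) x \<phi> = 0"
  shows "gKdV_smooth_solution q (\<lambda>t x. u0 x (\<theta> t x))"
  unfolding gKdV_smooth_solution_def
proof (intro conjI allI sm)
  fix t x
  have 1: "deriv (\<lambda>x. u0 x (\<theta> t x)) = (\<lambda>x. u1 x (\<theta> t x))"
    by (rule ext) (rule DERIV_imp_deriv[OF deriv_u0])
  have 2: "deriv (\<lambda>x. u1 x (\<theta> t x)) = (\<lambda>x. u2 (p3 x) x (\<theta> t x))"
    by (rule ext) (rule DERIV_imp_deriv[OF deriv_u1[OF p2']])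
  have 3: "(deriv ^^ 2) (\<lambda>x. u0 x (\<theta> t x)) = deriv (deriv (\<lambda>x. u0 x (\<theta> t x)))"
    by (simp add: numeral_2_eq_2)
  have "(deriv ^^ 2) (\<lambda>x. u0 x (\<theta> t x)) z + 2 * u0 z (\<theta> t z) ^ q = - (F1 (y z (\<theta> t z)) * yt z (\<theta> t z))" for z
    using res[of z "\<theta> t z"] unfolding 3 1 2 unfolding residual_def u0_def u2_def by (simp add: algebra_simps)
  moreover have "((\<lambda>x. - (F1 (y x (\<theta> t x)) * yt x (\<theta> t x))) has_real_derivative - deriv (\<lambda>s. u0 x (\<theta> s x)) t) (at x)"
    using smooth_plane_has_derivatives(1)[OF sm, of x t] unfolding deriv_v_time_deriv_space by (rule DERIV_minus)
  ultimately show "deriv (\<lambda>s. u0 x (\<theta> s x)) t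
      + deriv (\<lambda>x. (deriv ^^ 2) (\<lambda>x. u0 x (\<theta> t x)) x + 2 * u0 x (\<theta> t x) ^ q) x = 0"
    by (simp add: DERIV_imp_deriv)
qed

text \<open>With \<open>Q = 4 + y\<^sup>2\<close> one has \<open>F' = 4 / Q\<close>, \<open>F'' = - 8 y / Q\<^sup>2\<close> and \<open>F''' + 2 F'\<^sup>3 = 24 / Q\<^sup>2\<close>.  The equations for
\<open>p\<close> give \<open>y\<^sub>t + y\<^sub>x\<^sub>x\<^sub>x = - 3/2 a\<^sup>2 p\<^sup>2 y\<^sub>x\<close> and \<open>y\<^sub>x\<^sup>2 - y y\<^sub>x\<^sub>x = a\<^sup>2 p\<^sup>2 Q / 4\<close>; so the residual is a
multiple of \<open>y\<^sub>x\<close> and its factor is zero.\<close>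

lemma residual_zero_arctan_sech:
  assumes F: "\<And>y. F1 y = 4 / (4 + y\<^sup>2)" "\<And>y. F2 y = - (8 * y) / (4 + y\<^sup>2)\<^sup>2"
      "\<And>y. F3 y = - 8 / (4 + y\<^sup>2)\<^sup>2 + 32 * y\<^sup>2 / (4 + y\<^sup>2) ^ 3"
    and m: "m = - 8 * a\<^sup>2"
    and p: "(p1 x)\<^sup>2 = 3 * a\<^sup>2 * (p x)\<^sup>2 - a\<^sup>2 * p x ^ 4 / 4" "p2 x = 3 * a\<^sup>2 * p x - a\<^sup>2 * p x ^ 3 / 2"
  shows "residual 3 (3 * a\<^sup>2 * p1 x - 3 / 2 * a\<^sup>2 * (p x)\<^sup>2 * p1 x) x \<phi> = 0"
proof -
  define d where "d = 3 * a\<^sup>2 * p1 x - 3 / 2 * a\<^sup>2 * (p x)\<^sup>2 * p1 x"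
  define Y where "Y = y x \<phi>"
  define Q where "Q = 4 + Y\<^sup>2"
  have Q: "Q > 0" by (simp add: Q_def add_pos_nonneg)
  have F': "F1 Y = 4 / Q" "F2 Y = - (8 * Y) / Q\<^sup>2" "F3 Y + 2 * F1 Y ^ 3 = 24 / Q\<^sup>2"
  proof -
    show "F1 Y = 4 / Q" "F2 Y = - (8 * Y) / Q\<^sup>2" by (simp_all add: F Q_def)
    have "F3 Y + 2 * F1 Y ^ 3 = (- 8 * Q + 32 * Y\<^sup>2 + 128) / Q ^ 3"
      unfolding F Q_def[symmetric] using Q by (simp add: field_simps power2_eq_square power3_eq_cube)
    also have "- 8 * Q + 32 * Y\<^sup>2 + 128 = 24 * Q" by (simp add: Q_def)
    finally show "F3 Y + 2 * F1 Y ^ 3 = 24 / Q\<^sup>2" using Q by (simp add: power2_eq_square power3_eq_cube)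
  qed
  have yt: "yt x \<phi> = - 8 * a ^ 3 * p x * cos \<phi>"
    unfolding yt_def by (simp add: m power2_eq_square power3_eq_cube)
  have lin: "yt x \<phi> + y3 d x \<phi> = - 3 / 2 * a\<^sup>2 * (p x)\<^sup>2 * y1 x \<phi>"
    unfolding yt y3_def y1_def d_def p(2)
    by (simp add: field_simps power2_eq_square power3_eq_cube)
  have "(y1 x \<phi>)\<^sup>2 - Y * y2 x \<phi> = (sin \<phi>)\<^sup>2 * ((p1 x)\<^sup>2 - p x * p2 x + a\<^sup>2 * (p x)\<^sup>2) + a\<^sup>2 * (p x)\<^sup>2 * (cos \<phi>)\<^sup>2"
    unfolding y1_def Y_def y_def y2_def by (simp add: algebra_simps power2_eq_square)
  also have "\<dots> = a\<^sup>2 * (p x)\<^sup>2 * (Q / 4)"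
    unfolding cos_squared_eq p Q_def Y_def y_def by (simp add: field_simps power2_eq_square power3_eq_cube power4_eq_xxxx)
  finally have quad: "(y1 x \<phi>)\<^sup>2 = Y * y2 x \<phi> + a\<^sup>2 * (p x)\<^sup>2 * (Q / 4)" by simp
  have "residual 3 d x \<phi> = F1 Y * (yt x \<phi> + y3 d x \<phi>) + 3 * F2 Y * y1 x \<phi> * y2 x \<phi>
      + (F3 Y + 2 * F1 Y ^ 3) * (y1 x \<phi> * (y1 x \<phi>)\<^sup>2)"
    unfolding residual_def Y_def by (simp add: algebra_simps power2_eq_square power3_eq_cube)
  also have "\<dots> = 0"
    unfolding F'(3) unfolding F'(1,2) lin quad using Q by (simp add: field_simps power2_eq_square)
  finally show ?thesis unfolding d_def .
qed

end

lemma gKdV_time_shift: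
  assumes u: "gKdV_smooth_solution q u" and sm: "smooth_plane (\<lambda>t x. u (t + \<tau>) x)"
  shows "gKdV_smooth_solution q (\<lambda>t x. u (t + \<tau>) x)"
  unfolding gKdV_smooth_solution_def
proof (intro conjI allI sm)
  fix t x
  have "smooth_plane u" using u by (simp add: gKdV_smooth_solution_def)
  from smooth_plane_has_derivatives(1)[OF this, of x "t + \<tau>"]
  have "deriv (\<lambda>s. u (s + \<tau>) x) t = deriv (\<lambda>s. u s x) (t + \<tau>)"
    unfolding DERIV_shift by (rule DERIV_imp_deriv)
  thus "deriv (\<lambda>s. u (s + \<tau>) x) t
      + deriv (\<lambda>z. (deriv ^^ 2) (u (t + \<tau>)) z + 2 * u (t + \<tau>) z ^ q) x = 0"
    using u by (simp add: gKdV_smooth_solution_def)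
qed

lemma B_time_shift:
  assumes "\<alpha> > 0"
  shows "B \<alpha> x1 x2 t x = B \<alpha> 0 x2 (t + - x1 / (64 * \<alpha> ^ 3)) x"
  using assms by (simp add: B_def algebra_simps)

lemma sech_tendsto_0:
  assumes "\<beta> > (0::real)"
  shows "((\<lambda>x. 1 / cosh (\<beta> * x + c)) \<longlongrightarrow> 0) at_infinity"
proof -
  have 1: "filterlim (\<lambda>x. c + \<beta> * x) at_top at_top"
    using assms by (intro filterlim_tendsto_add_at_top[OF tendsto_const]
        filterlim_tendsto_pos_mult_at_top[OF tendsto_const] filterlim_ident)
  have 2: "filterlim (\<lambda>x. - c + \<beta> * - x) at_top at_bot"
    using assms by (intro filterlim_tendsto_add_at_top[OF tendsto_const]
        filterlim_tendsto_pos_mult_at_top[OF tendsto_const] filterlim_uminus_at_top_at_bot)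
  have even: "cosh (- c + \<beta> * - x) = cosh (c + \<beta> * x)" for x
    using cosh_minus[of "c + \<beta> * x"] by simp
  have "filterlim (\<lambda>x. cosh (c + \<beta> * x)) at_top (sup at_top at_bot)"
    by (intro filterlim_sup filterlim_compose[OF cosh_real_at_top 1]
        filterlim_compose[OF cosh_real_at_top 2, unfolded even])
  hence "((\<lambda>x. inverse (cosh (c + \<beta> * x))) \<longlongrightarrow> 0) at_infinity"
    unfolding at_infinity_eq_at_top_bot by (rule tendsto_inverse_0_at_top)
  thus ?thesis by (simp add: inverse_eq_divide add.commute)
qed

text \<open>The profile is \<open>2 arctan (y / 2)\<close> with \<open>F'(0) = 1\<close>, so that the envelope is the hyperbolic secant of
amplitude \<open>2 \<surd>3\<close>; the minus sign of \<open>B\<close> is put into the envelope.\<close>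

lemma B_is_breather:
  assumes \<alpha>: "\<alpha> > 0"
  shows "quasimonochromatic_breather_with 3 (- 32 * \<alpha>\<^sup>2) \<alpha> (\<lambda>y. 2 * arctan (y / 2))
    (\<lambda>x. - (2 * sqrt 3) / cosh (2 * sqrt 3 * \<alpha> * x + x2)) (B \<alpha> 0 x2)"
proof -
  define a where "a = 2 * \<alpha>"
  define \<beta> where "\<beta> = 2 * sqrt 3 * \<alpha>"
  have \<beta>: "\<beta> > 0" "\<beta>\<^sup>2 = 3 * a\<^sup>2" using \<alpha> by (simp_all add: \<beta>_def a_def power_mult_distrib)
  define T where "T = (\<lambda>x. tanh (\<beta> * x + x2))"
  define p where "p = (\<lambda>x. - (2 * sqrt 3) / cosh (\<beta> * x + x2))"
  define p1 where "p1 = (\<lambda>x. - \<beta> * (p x * T x))"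
  define p2 where "p2 = (\<lambda>x. 3 * a\<^sup>2 * p x - a\<^sup>2 * p x ^ 3 / 2)"
  define p3 where "p3 = (\<lambda>x. 3 * a\<^sup>2 * p1 x - 3 / 2 * a\<^sup>2 * (p x)\<^sup>2 * p1 x)"
  have T: "(T x)\<^sup>2 = 1 - (p x)\<^sup>2 / 12" for x
  proof -
    have "cosh (\<beta> * x + x2) \<noteq> 0" by simp
    moreover have "(sinh (\<beta> * x + x2))\<^sup>2 = (cosh (\<beta> * x + x2))\<^sup>2 - 1" by (simp add: sinh_square_eq)
    ultimately show ?thesis
      by (simp add: T_def p_def tanh_def power_divide power_mult_distrib diff_divide_distrib)
  qed
  have dT: "(T has_real_derivative \<beta> * ((p x)\<^sup>2 / 12)) (at x)" for x
  proof -
    have "(T has_real_derivative (1 - (T x)\<^sup>2) * \<beta>) (at x)"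
      unfolding T_def by (auto intro!: derivative_eq_intros)
    thus ?thesis by (simp add: T mult.commute)
  qed
  have dp: "(p has_real_derivative p1 x) (at x)" for x
    unfolding p_def p1_def T_def tanh_def
    by (auto intro!: derivative_eq_intros simp: power2_eq_square)
  have dp1: "(p1 has_real_derivative p2 x) (at x)" for x
  proof -
    have "(p1 has_real_derivative - \<beta> * (p1 x * T x + \<beta> * ((p x)\<^sup>2 / 12) * p x)) (at x)"
      unfolding p1_def[abs_def] using DERIV_cmult[OF DERIV_mult[OF dp dT], of "- \<beta>" x] by (simp add: p1_def)
    also have "- \<beta> * (p1 x * T x + \<beta> * ((p x)\<^sup>2 / 12) * p x) = \<beta>\<^sup>2 * (p x * (T x)\<^sup>2 - p x ^ 3 / 12)"
      by (simp add: p1_def algebra_simps power2_eq_square power3_eq_cube)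
    also have "\<dots> = p2 x" unfolding \<beta> T p2_def by (simp add: field_simps power2_eq_square power3_eq_cube)
    finally show ?thesis .
  qed
  have dp2: "(p2 has_real_derivative p3 x) (at x)" for x
    unfolding p2_def p3_def by (auto intro!: derivative_eq_intros dp)
  have en: "(p1 x)\<^sup>2 = 3 * a\<^sup>2 * (p x)\<^sup>2 - a\<^sup>2 * p x ^ 4 / 4" for x
  proof -
    have "(p1 x)\<^sup>2 = \<beta>\<^sup>2 * (p x)\<^sup>2 * (T x)\<^sup>2" by (simp add: p1_def power_mult_distrib)
    thus ?thesis unfolding \<beta> T by (simp add: field_simps power2_eq_square power4_eq_xxxx)
  qed
  interpret ansatz "- 32 * \<alpha>\<^sup>2" a "\<lambda>y. 2 * arctan (y / 2)" "\<lambda>y. 4 / (4 + y\<^sup>2)" "\<lambda>y. - (8 * y) / (4 + y\<^sup>2)\<^sup>2"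
    "\<lambda>y. - 8 / (4 + y\<^sup>2)\<^sup>2 + 32 * y\<^sup>2 / (4 + y\<^sup>2) ^ 3"
    "\<lambda>y. 96 * y / (4 + y\<^sup>2) ^ 3 - 192 * y ^ 3 / (4 + y\<^sup>2) ^ 4" p p1 p2
  proof
    fix x :: real
    show "isCont p2 x" by (rule DERIV_isCont[OF dp2])
  qed (rule arctan_derivatives dp dp1)+
  have Bu: "B \<alpha> 0 x2 t x = u0 x (\<theta> t x)" for t x
  proof -
    have arg: "2 * arctan (y z (\<theta> t z) / 2) = - 2 * arctan (sqrt 3 *
       (sin (2 * \<alpha> * z - 64 * \<alpha> ^ 3 * t + 0) / cosh (2 * sqrt 3 * \<alpha> * z + x2)))" for z
    proof -
      have phase: "\<theta> t z = 2 * \<alpha> * z - 64 * \<alpha> ^ 3 * t + 0"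
        by (simp add: a_def algebra_simps power2_eq_square power3_eq_cube)
      have "y z (\<theta> t z) / 2 = - (sqrt 3 * (sin (\<theta> t z) / cosh (\<beta> * z + x2)))"
        unfolding y_def by (simp add: p_def)
      thus ?thesis unfolding phase \<beta>_def by (simp add: arctan_minus)
    qed
    from deriv_v[of t x, unfolded arg] have "((\<lambda>z. - 2 * arctan (sqrt 3 *
       (sin (2 * \<alpha> * z - 64 * \<alpha> ^ 3 * t + 0) / cosh (2 * sqrt 3 * \<alpha> * z + x2)))) has_real_derivative u0 x (\<theta> t x)) (at x)" .
    from DERIV_cdivide[OF this, of "- 2"] have "deriv (\<lambda>z. arctan (sqrt 3 *
       (sin (2 * \<alpha> * z - 64 * \<alpha> ^ 3 * t + 0) / cosh (2 * sqrt 3 * \<alpha> * z + x2)))) x = u0 x (\<theta> t x) / - 2"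
      by (intro DERIV_imp_deriv) simp
    thus ?thesis unfolding B_def by simp
  qed
  hence Beq: "B \<alpha> 0 x2 = (\<lambda>t x. u0 x (\<theta> t x))" by (intro ext)
  have sol: "gKdV_smooth_solution 3 (B \<alpha> 0 x2)"
    unfolding Beq
  proof (rule solution_if_residual_zero[OF _ dp2])
    show "smooth_plane (\<lambda>t x. u0 x (\<theta> t x))" using B_smooth_plane[of \<alpha> 0 x2] unfolding Beq .
    show "residual 3 (p3 x) x \<phi> = 0" for x \<phi>
      unfolding p3_def by (rule residual_zero_arctan_sech) (use en in \<open>auto simp: p2_def a_def power_mult_distrib\<close>)
  qed
  have derivs: "deriv p = p1" "deriv p1 = p2"
    by (auto intro!: ext DERIV_imp_deriv dp dp1)
  have it: "(deriv ^^ 2) p = p2" by (simp add: numeral_2_eq_2 derivs)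
  have Ck: "C_k 2 p"
  proof -
    have "\<forall>x. (deriv ^^ j) p differentiable (at x)" if "j < 2" for j
    proof -
      from that have "j = 0 \<or> j = 1" by linarith
      moreover have "p differentiable (at x)" "p1 differentiable (at x)" for x
        using dp dp1 unfolding real_differentiable_def by blast+
      ultimately show ?thesis by (auto simp: derivs)
    qed
    moreover have "continuous_on UNIV p2"
      by (intro continuous_at_imp_continuous_on ballI DERIV_isCont[OF dp2])
    ultimately show ?thesis unfolding C_k_def it by blast
  qed
  have lim: "(p \<longlongrightarrow> 0) at_infinity"
    using tendsto_mult_right_zero[OF sech_tendsto_0[OF \<beta>(1), of x2], of "- (2 * sqrt 3)"] by (simp add: p_def)
  have "\<bar>T x\<bar> \<le> 1" for x using abs_le_square_iff[of "T x" 1] T[of x] by simp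
  hence "((\<lambda>x. p x * T x) \<longlongrightarrow> 0) at_infinity" by (rule tendsto_phase_modulated[OF lim])
  from tendsto_mult_right_zero[OF this] have lim1: "(p1 \<longlongrightarrow> 0) at_infinity" unfolding p1_def .
  have "(p2 \<longlongrightarrow> 3 * a\<^sup>2 * 0 - a\<^sup>2 * 0 ^ 3 / 2) at_infinity"
    unfolding p2_def by (intro tendsto_intros lim) auto
  hence lim2: "(p2 \<longlongrightarrow> 0) at_infinity" by simp
  have Bd: "B \<alpha> 0 x2 t x = deriv (\<lambda>z. 2 * arctan (p z * sin (2 * \<alpha> * (z + - 32 * \<alpha>\<^sup>2 * t)) / 2)) x" for t x
    unfolding Bu using DERIV_imp_deriv[OF deriv_v[of t x]] by (simp add: y_def a_def)
  have "p 0 \<noteq> 0" by (simp add: p_def)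
  hence p_nz: "p \<noteq> (\<lambda>_. 0)" by auto
  have F_nz: "(\<lambda>y::real. 2 * arctan (y / 2)) \<noteq> (\<lambda>_. 0)"
    by (auto simp: arctan_eq_zero_iff dest: fun_cong[of _ _ 1])
  show ?thesis
    unfolding p_def[symmetric, folded \<beta>_def] \<beta>_def[symmetric] quasimonochromatic_breather_with_def
    using sol Bd \<alpha> smooth_arctan p_nz F_nz Ck lim lim1 lim2 by (simp add: derivs it p_def[symmetric])
qed

section \<open>The classification\<close>

theorem theorem1p1:
  shows "(\<forall>q::nat. q \<ge> 2 \<and> q \<noteq> 3 \<longrightarrow>
            \<not> (\<exists>u. quasimonochromatic_breather_analytic_profile q u \<and> u \<noteq> (\<lambda>t x. 0))) \<and>
         (\<forall>\<alpha> x1 x2. \<alpha> > 0 \<longrightarrow>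
            gKdV_smooth_solution 3 (B \<alpha> x1 x2) \<and>
            B \<alpha> x1 x2 \<noteq> (\<lambda>t x. 0) \<and>
            (\<exists>t0 x0. quasimonochromatic_breather_analytic_profile 3
                       (\<lambda>t x. B \<alpha> x1 x2 (t + t0) (x + x0))) \<and>
            (\<forall>u. quasimonochromatic_breather_analytic_profile 3 u \<and> u \<noteq> (\<lambda>t x. 0) \<longrightarrow>
               (\<exists>l>0. \<exists>t0 x0. u = (\<lambda>t x. l * B \<alpha> x1 x2 (l ^ 3 * (t + t0)) (l * (x + x0))))))"
proof (intro conjI allI impI)
  fix q :: nat
  assume q: "q \<ge> 2 \<and> q \<noteq> 3"
  show "\<not> (\<exists>u. quasimonochromatic_breather_analytic_profile q u \<and> u \<noteq> (\<lambda>t x. 0))"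
    unfolding quasimonochromatic_breather_analytic_profile_def
    using q quasimonochromatic_breather_explicit by blast
next
  fix \<alpha> x1 x2 :: real
  assume \<alpha>: "\<alpha> > 0"
  note br = B_is_breather[OF \<alpha>, of x2]
  have sol0: "gKdV_smooth_solution 3 (B \<alpha> 0 x2)" using br by (simp add: quasimonochromatic_breather_with_def)
  have shift: "B \<alpha> x1 x2 = (\<lambda>t x. B \<alpha> 0 x2 (t + - x1 / (64 * \<alpha> ^ 3)) x)"
    using B_time_shift[OF \<alpha>] by (intro ext)
  show "gKdV_smooth_solution 3 (B \<alpha> x1 x2)"
    unfolding shift by (rule gKdV_time_shift[OF sol0]) (use B_smooth_plane[of \<alpha> x1 x2] shift in simp)
  show "B \<alpha> x1 x2 \<noteq> (\<lambda>t x. 0)" by (rule B_nonzero[OF \<alpha>])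
  have "(\<lambda>t x. B \<alpha> x1 x2 (t + x1 / (64 * \<alpha> ^ 3)) (x + 0)) = B \<alpha> 0 x2" by (simp add: shift)
  moreover have "quasimonochromatic_breather_analytic_profile 3 (B \<alpha> 0 x2)"
    unfolding quasimonochromatic_breather_analytic_profile_def
    using br arctan_real_analytic open_UNIV UNIV_I by blast
  ultimately have "quasimonochromatic_breather_analytic_profile 3
      (\<lambda>t x. B \<alpha> x1 x2 (t + x1 / (64 * \<alpha> ^ 3)) (x + 0))" by simp
  thus "\<exists>t0 x0. quasimonochromatic_breather_analytic_profile 3 (\<lambda>t x. B \<alpha> x1 x2 (t + t0) (x + x0))"
    by blast
  fix u :: "real \<Rightarrow> real \<Rightarrow> real"
  assume u: "quasimonochromatic_breather_analytic_profile 3 u \<and> u \<noteq> (\<lambda>t x. 0)"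
  then obtain m \<alpha>' F p where bu: "quasimonochromatic_breather_with 3 m \<alpha>' F p u"
    unfolding quasimonochromatic_breather_analytic_profile_def by blast
  hence \<alpha>': "\<alpha>' > 0" by (simp add: quasimonochromatic_breather_with_def)
  obtain \<epsilon> x2' where "(3::nat) = 3" and explicit: "\<epsilon> = 1 \<or> \<epsilon> = -1"
    "\<And>t x. u t x = 2 * deriv (\<lambda>x. arctan (\<epsilon> * sqrt 3 *
        (sin (2 * \<alpha>' * x - 64 * \<alpha>' ^ 3 * t) / cosh (2 * sqrt 3 * \<alpha>' * x + x2')))) x"
    by (rule quasimonochromatic_breather_explicit[OF bu _ conjunct2[OF u]], simp, rule that)
  from breather_is_scaled_shifted_B[OF \<alpha> \<alpha>' explicit]
  show "\<exists>l>0. \<exists>t0 x0. u = (\<lambda>t x. l * B \<alpha> x1 x2 (l ^ 3 * (t + t0)) (l * (x + x0)))" .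
qed

end
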